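(* Let $E \subset \mathbb{R}$ be a symmetric Cantor set of positive Lebesgue measure. Then $E$ cannot weakly tile its complement $\mathbb{R} \setminus E$ by translations. As a consequence, $E$ is not spectral.
   Context: Symmetric Cantor set: let $\{\xi_k\}$, $k=1,2,\dots$, be a sequence of real numbers such that $0 < \xi_k < \frac12$ for all $k$. The symmetric Cantor set associated to the ratio sequence $\{\xi_k\}$ is the closed set $E(\xi_1,\xi_2,\dots) \subset \mathbb{R}$ obtained from the interval $[0,1]$ by a Cantor type construction, where at the $k$'th step one removes from each one of the intervals of the previous step a central open interval of relative length $1-2\xi_k$, so that after the $k$'th step one obtains $2^k$ closed intervals of common length $\xi_1 \cdots \xi_k$; $E(\xi_1,\xi_2,\dots)$ is the intersection over all $k$ of the unions of these $2^k$ intervals. A symmetric Cantor set is a set of the form $E(\xi_1,\xi_2,\dots)$ for some such sequence. Weak tiling: a bounded, measurable set $\Omega \subset \mathbb{R}^d$ can weakly tile a measurable (possibly unbounded) set $\Sigma \subset \mathbb{R}^d$ by translations if there exists a positive, locally finite Borel measure $\nu$ on $\mathbb{R}^d$ such that $\mathbf{1}_{\Omega} * \nu = \mathbf{1}_{\Sigma}$ almost everywhere with respect to Lebesgue measure. A bounded, measurable set $\Omega \subset \mathbb{R}^d$ of positive Lebesgue measure is called spectral if there exists a countable set $\Lambda \subset \mathbb{R}^d$ such that the system of exponential functions $\{\exp 2\pi i \langle \lambda, x\rangle\}$, $\lambda \in \Lambda$, forms an orthogonal basis in $L^2(\Omega)$ (that is, the system is orthogonal and complete in $L^2(\Omega)$).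 *)

theory Defs
  imports "HOL-Analysis.Analysis"
begin

text \<open>
  An interval of the construction is represented by the pair of its endpoints.  Removing from
  \<open>{a..b}\<close> the central open interval of relative length \<open>1 - 2 * r\<close> leaves the two intervals
  below; see \<open>remove_central_interval\<close>.  Ratio sequences are indexed from 1, so \<open>\<xi> 0\<close> is irrelevant.
\<close>

definition cantor_children :: "real \<Rightarrow> real \<times> real \<Rightarrow> (real \<times> real) set" where
  "cantor_children r = (\<lambda>(a, b). {(a, a + r * (b - a)), (b - r * (b - a), b)})"

primrec cantor_intervals :: "(nat \<Rightarrow> real) \<Rightarrow> nat \<Rightarrow> (real \<times> real) set" where
  "cantor_intervals \<xi> 0 = {(0, 1)}"
| "cantor_intervals \<xi> (Suc k) = (\<Union>I \<in> cantor_intervals \<xi> k. cantor_children (\<xi> (Suc k)) I)"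

definition cantor_set :: "(nat \<Rightarrow> real) \<Rightarrow> real set" where
  "cantor_set \<xi> = (\<Inter>k. \<Union>(a, b) \<in> cantor_intervals \<xi> k. {a..b})"

definition symmetric_Cantor_set :: "real set \<Rightarrow> bool" where
  "symmetric_Cantor_set E \<longleftrightarrow>
     (\<exists>\<xi>. (\<forall>k\<ge>1. 0 < \<xi> k \<and> \<xi> k < 1 / 2) \<and> E = cantor_set \<xi>)"

lemma remove_central_interval:
  fixes a b r :: real
  assumes "a < b" "0 < r" "r < 1 / 2"
  shows "{a..b} - {(a + b) / 2 - (1 - 2 * r) * (b - a) / 2 <..< (a + b) / 2 + (1 - 2 * r) * (b - a) / 2}
    = (\<Union>(c, d) \<in> cantor_children r (a, b). {c..d})"
proof -
  have eqs: "(a + b) / 2 - (1 - 2 * r) * (b - a) / 2 = a + r * (b - a)"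
    "(a + b) / 2 + (1 - 2 * r) * (b - a) / 2 = b - r * (b - a)"
    by (simp_all add: field_simps)
  have "0 < r * (b - a)" "r * (b - a) < (1 / 2) * (b - a)"
    using assms by (simp, intro mult_strict_right_mono, auto)
  then show ?thesis
    unfolding eqs cantor_children_def by auto
qed

lemma cantor_intervals_length:
  "(a, b) \<in> cantor_intervals \<xi> k \<Longrightarrow> b - a = (\<Prod>i=1..k. \<xi> i)"
proof (induction k arbitrary: a b)
  case (Suc k)
  then show ?case by (fastforce simp: cantor_children_def)
qed simp

lemma finite_cantor_intervals: "finite (cantor_intervals \<xi> k)"
  by (induction k) (auto simp: cantor_children_def)

lemma compact_cantor_set: "compact (cantor_set \<xi>)"
proof -
  have c: "compact (\<Union>(a, b) \<in> cantor_intervals \<xi> k. {a..b})" for k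
    using finite_cantor_intervals by (intro compact_UN) auto
  then have "closed (cantor_set \<xi>)"
    unfolding cantor_set_def by (intro closed_INT ballI compact_imp_closed)
  moreover have "cantor_set \<xi> \<subseteq> {0..1}"
    unfolding cantor_set_def using INT_lower[of 0 UNIV "\<lambda>k. \<Union>(a, b) \<in> cantor_intervals \<xi> k. {a..b}"]
    by simp
  ultimately show ?thesis
    using bounded_subset[OF bounded_closed_interval] by (auto simp: compact_eq_bounded_closed)
qed

lemma symmetric_Cantor_set_compact: "symmetric_Cantor_set E \<Longrightarrow> compact E"
  unfolding symmetric_Cantor_set_def using compact_cantor_set by auto

text \<open>
  Weak tiling and spectrality are meant for bounded measurable \<open>\<Omega>\<close> (of positive measure in the
  case of spectrality).  These conditions are not repeated in the definitions; for symmetric Cantor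
  sets boundedness and measurability follow from the preceding lemma.
\<close>

definition locally_finite_borel :: "'a::euclidean_space measure \<Rightarrow> bool" where
  "locally_finite_borel \<nu> \<longleftrightarrow>
     sets \<nu> = sets borel \<and> (\<forall>x. \<exists>U. open U \<and> x \<in> U \<and> emeasure \<nu> U < \<infinity>)"

definition indicator_convolution :: "'a::euclidean_space set \<Rightarrow> 'a measure \<Rightarrow> 'a \<Rightarrow> ennreal" where
  "indicator_convolution \<Omega> \<nu> x = (\<integral>\<^sup>+ y. indicator \<Omega> (x - y) \<partial>\<nu>)"

definition weakly_tiles :: "'a::euclidean_space set \<Rightarrow> 'a set \<Rightarrow> bool" where
  "weakly_tiles \<Omega> S \<longleftrightarrow>
     (\<exists>\<nu>. locally_finite_borel \<nu> \<and>
          (AE x in lebesgue. indicator_convolution \<Omega> \<nu> x = indicator S x))"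

definition expo :: "'a::euclidean_space \<Rightarrow> 'a \<Rightarrow> complex" where
  "expo l x = exp (2 * of_real pi * \<i> * of_real (l \<bullet> x))"

definition square_integrable_on :: "('a::euclidean_space \<Rightarrow> complex) \<Rightarrow> 'a set \<Rightarrow> bool" where
  "square_integrable_on f \<Omega> \<longleftrightarrow>
     f \<in> borel_measurable (lebesgue_on \<Omega>) \<and> integrable (lebesgue_on \<Omega>) (\<lambda>x. (cmod (f x))\<^sup>2)"

definition L2_inner :: "'a::euclidean_space set \<Rightarrow> ('a \<Rightarrow> complex) \<Rightarrow> ('a \<Rightarrow> complex) \<Rightarrow> complex" where
  "L2_inner \<Omega> f g = (LINT x|lebesgue_on \<Omega>. f x * cnj (g x))"

definition L2_norm_on :: "'a::euclidean_space set \<Rightarrow> ('a \<Rightarrow> complex) \<Rightarrow> real" where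
  "L2_norm_on \<Omega> f = sqrt (LINT x|lebesgue_on \<Omega>. (cmod (f x))\<^sup>2)"

text \<open>Completeness means that finite linear combinations of the exponentials are dense.\<close>

definition spectral :: "'a::euclidean_space set \<Rightarrow> bool" where
  "spectral \<Omega> \<longleftrightarrow>
     (\<exists>\<Lambda>. countable \<Lambda> \<and>
        (\<forall>l\<in>\<Lambda>. \<forall>m\<in>\<Lambda>. l \<noteq> m \<longrightarrow> L2_inner \<Omega> (expo l) (expo m) = 0) \<and>
        (\<forall>f. square_integrable_on f \<Omega> \<longrightarrow>
           (\<forall>\<epsilon>>0. \<exists>F c. finite F \<and> F \<subseteq> \<Lambda> \<and>
              L2_norm_on \<Omega> (\<lambda>x. f x - (\<Sum>l\<in>F. c l * expo l x)) < \<epsilon>)))"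

end

(*
  Write E = ctail 0.  At a fine level k the set E is a union of translates of its leftmost piece
  T, and the remaining ratios are so close to 1/2 that T meets T + z in positive measure whenever
  the convex hulls of the two sets overlap.  Let G lie in the central gap of T.  A translate
  E + y that meets G contains a translate of T whose hull overlaps that of T; quantitatively
  |G Int (E + y)| <= C |E Int (E + y)|.  Integrating 1_E * nu = 1 - 1_E over E and over G
  therefore gives a contradiction.

  If Lambda is a spectrum, F a finite subset and S the sum of the exponentials in F, then
  nu = |S|^2 / (card F |E|) dx satisfies 1_E * nu = 1 exactly, by orthogonality.  The integral of
  |E Int (E + y)| (1 - cos (2 pi t y)) |S y|^2 dy is, by Parseval, the sum of |1_E^(l - m + t)|^2
  over l in F and m in Lambda - F.  For F = Lambda Int [-r, r] and on average over t this is
  o(card F), since Lambda is separated and 1_E^ is square integrable.  So the mass of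
  |E Int (E + y)| dnu concentrates at y = 0 as r grows, while |G Int (E + y)|, which it dominates,
  vanishes near 0 and has integral |G|.
*)
theory Submission
  imports Defs
begin

section \<open>Symmetric Cantor sets\<close>

text \<open>Positive measure enters through densities: 2^n times the length of a level n interval
  decreases to |E|, so deep pieces fill almost all of their hulls, and two such pieces cannot
  interlace without meeting once their hulls overlap substantially. Non-spectrality would follow
  from the first claim if a spectrum produced a weak tiling of the complement, but that passes
  through a weak limit of the measures nu from which the unit mass at 0 is split off. Here
  everything is estimated for finite F instead. The mass near 0 never has to be identified, because
  G is kept at a distance \<open>\<delta>\<close> from E: translates by |y| <
  \<open>\<delta>\<close> miss G, and for \<open>\<delta>\<close> \<le> |y| \<le> 1 the factor 1 -
  cos (2 pi t y) is bounded below when t runs through [1/4, 3/8). The length 1/8 of this window is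
  the separation of the spectrum, so averaging over t unfolds a sum over \<open>\<Lambda>\<close>
  into an integral over the line without multiplicity.\<close>

definition clen :: "(nat \<Rightarrow> real) \<Rightarrow> nat \<Rightarrow> real" where
  "clen \<xi> k = (\<Prod>i=1..k. \<xi> i)"

text \<open>Distance between the left endpoints of the two children of a level \<open>k\<close>
  interval, which both have length \<open>clen \<xi> (Suc k)\<close>.\<close>

definition cstep :: "(nat \<Rightarrow> real) \<Rightarrow> nat \<Rightarrow> real" where
  "cstep \<xi> k = clen \<xi> k - clen \<xi> (Suc k)"

text \<open>
  \<open>coffsets \<xi> k n\<close> lists the left endpoints of the level \<open>k + n\<close> intervals inside one level \<open>k\<close>
  interval that has been moved to start at 0.
\<close>

primrec coffsets :: "(nat \<Rightarrow> real) \<Rightarrow> nat \<Rightarrow> nat \<Rightarrow> real set" where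
  "coffsets \<xi> k 0 = {0}"
| "coffsets \<xi> k (Suc n) = coffsets \<xi> k n \<union> (\<lambda>x. x + cstep \<xi> (k + n)) ` coffsets \<xi> k n"

definition capprox :: "(nat \<Rightarrow> real) \<Rightarrow> nat \<Rightarrow> nat \<Rightarrow> real set" where
  "capprox \<xi> k n = (\<Union>a\<in>coffsets \<xi> k n. {a..a + clen \<xi> (k + n)})"

text \<open>The piece of the Cantor set in its leftmost level \<open>k\<close> interval; up to
  scaling, the Cantor set of the ratios from index \<open>k + 1\<close> on.\<close>

definition ctail :: "(nat \<Rightarrow> real) \<Rightarrow> nat \<Rightarrow> real set" where
  "ctail \<xi> k = (\<Inter>n. capprox \<xi> k n)"

lemma cantor_intervals_eq:
  "cantor_intervals \<xi> n = (\<lambda>a. (a, a + clen \<xi> n)) ` coffsets \<xi> 0 n"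
proof (induction n)
  case 0
  then show ?case by (simp add: clen_def)
next
  case (Suc n)
  have "cantor_children (\<xi> (Suc n)) (a, a + clen \<xi> n) =
      {(a, a + clen \<xi> (Suc n)), (a + cstep \<xi> n, a + cstep \<xi> n + clen \<xi> (Suc n))}" for a
    by (simp add: cantor_children_def cstep_def clen_def mult.commute diff_add_eq add_diff_eq)
  then show ?case by (auto simp: Suc)
qed

lemma cantor_set_eq_ctail: "cantor_set \<xi> = ctail \<xi> 0"
  unfolding cantor_set_def ctail_def capprox_def cantor_intervals_eq by simp

text \<open>The recursion performs the finest splitting last, matching
  \<open>cantor_intervals\<close>; self-similarity needs the coarsest splitting first. The orders
  agree because an offset is a sum of independently chosen steps.\<close>

lemma coffsets_head:
  "coffsets \<xi> k (Suc n) = coffsets \<xi> (Suc k) n \<union> (\<lambda>x. x + cstep \<xi> k) ` coffsets \<xi> (Suc k) n"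
proof (induction n)
  case (Suc n)
  have "coffsets \<xi> k (Suc (Suc n)) =
     coffsets \<xi> k (Suc n) \<union> (\<lambda>x. x + cstep \<xi> (k + Suc n)) ` coffsets \<xi> k (Suc n)"
    by simp
  also have "\<dots> = coffsets \<xi> (Suc k) (Suc n) \<union> (\<lambda>x. x + cstep \<xi> k) ` coffsets \<xi> (Suc k) (Suc n)"
    unfolding Suc.IH by (simp add: image_Un image_image ac_simps)
  finally show ?case .
qed simp

lemma capprox_head:
  "capprox \<xi> k (Suc n) = capprox \<xi> (Suc k) n \<union> (\<lambda>x. x + cstep \<xi> k) ` capprox \<xi> (Suc k) n"
  unfolding capprox_def coffsets_head
  by (simp add: image_UN UN_Un image_Un ac_simps)

lemma finite_coffsets: "finite (coffsets \<xi> k n)"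
  by (induction n) auto

lemma compact_capprox: "compact (capprox \<xi> k n)"
  unfolding capprox_def using finite_coffsets by (intro compact_UN) auto

lemma closed_ctail: "closed (ctail \<xi> k)"
  unfolding ctail_def by (intro closed_INT ballI compact_imp_closed compact_capprox)

lemma sets_capprox [measurable]: "capprox \<xi> k n \<in> sets borel"
  using compact_capprox by (intro borel_closed compact_imp_closed)

lemma sets_ctail [measurable]: "ctail \<xi> k \<in> sets borel"
  using closed_ctail by (intro borel_closed)

section \<open>Lebesgue measure of translates\<close>

lemma sets_shift_borel [measurable]:
  fixes A :: "real set"
  assumes "A \<in> sets borel"
  shows "(\<lambda>x. x + y) ` A \<in> sets borel"
proof -
  have "(\<lambda>x. x + y) ` A = (\<lambda>x. x - y) -` A \<inter> space borel"
    by (auto simp: image_iff) (metis diff_add_cancel)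
  also have "\<dots> \<in> sets borel"
    using assms by measurable
  finally show ?thesis .
qed

lemma emeasure_lborel_shift:
  fixes A :: "real set"
  assumes "A \<in> sets borel"
  shows "emeasure lborel ((\<lambda>x. x + y) ` A) = emeasure lborel A"
proof -
  have "emeasure lborel ((\<lambda>x. x + y) ` A) = emeasure (distr lborel borel ((+) y)) ((\<lambda>x. x + y) ` A)"
    by (simp add: lborel_distr_plus)
  also have "\<dots> = emeasure lborel ((+) y -` ((\<lambda>x. x + y) ` A) \<inter> space lborel)"
    by (rule emeasure_distr) (auto intro!: sets_shift_borel assms)
  also have "(+) y -` ((\<lambda>x. x + y) ` A) \<inter> space lborel = A"
    by (auto simp: add.commute)
  finally show ?thesis .
qed

lemma measure_lborel_shift:
  fixes A :: "real set"
  assumes "A \<in> sets borel"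
  shows "measure lborel ((\<lambda>x. x + y) ` A) = measure lborel A"
  using emeasure_lborel_shift[OF assms] by (simp add: measure_def)

lemma measure_lborel_Int_shift:
  fixes A :: "real set"
  assumes "A \<in> sets borel"
  shows "measure lborel (A \<inter> (\<lambda>x. x + y) ` A) = measure lborel (A \<inter> (\<lambda>x. x + (- y)) ` A)"
proof -
  have "(\<lambda>x. x + y) ` (A \<inter> (\<lambda>x. x + (- y)) ` A) = A \<inter> (\<lambda>x. x + y) ` A"
    by (force simp: image_iff)
  moreover have "A \<inter> (\<lambda>x. x + (- y)) ` A \<in> sets borel"
    using assms sets_shift_borel by blast
  ultimately show ?thesis
    using measure_lborel_shift by metis
qed

section \<open>Geometry of the pieces\<close>

context
  fixes \<xi> :: "nat \<Rightarrow> real"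
  assumes ratio: "\<And>k. 1 \<le> k \<Longrightarrow> 0 < \<xi> k \<and> \<xi> k < 1 / 2"
begin

lemma clen_pos: "0 < clen \<xi> k"
  unfolding clen_def using ratio by (intro prod_pos) auto

lemma clen_Suc_less: "2 * clen \<xi> (Suc k) < clen \<xi> k"
  using mult_strict_left_mono[of "\<xi> (Suc k)" "1 / 2" "clen \<xi> k"] ratio[of "Suc k"] clen_pos[of k]
  by (simp add: clen_def mult.commute)

lemma cstep_bounds: "clen \<xi> (Suc k) < cstep \<xi> k" "cstep \<xi> k < clen \<xi> k" "0 < cstep \<xi> k"
  using clen_Suc_less[of k] clen_pos[of "Suc k"] by (auto simp: cstep_def)

text \<open>Makes the gap of the leftmost piece a gap of the whole set: every other level
  \<open>n\<close> interval starts strictly to the right of the leftmost one, which ends at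
  \<open>clen \<xi> n\<close>.\<close>

lemma coffsets_bounds:
  assumes "a \<in> coffsets \<xi> 0 n" "a \<noteq> 0"
  shows "clen \<xi> n < a"
  using assms
proof (induction n arbitrary: a)
  case (Suc n)
  have *: "0 \<le> b" if "b \<in> coffsets \<xi> 0 n" for b
    using Suc.IH[OF that] clen_pos[of n] by (cases "b = 0") auto
  from Suc.prems consider "a \<in> coffsets \<xi> 0 n"
    | b where "b \<in> coffsets \<xi> 0 n" "a = b + cstep \<xi> n" by auto
  then show ?case
  proof cases
    case 1
    then have "clen \<xi> n < a" using Suc by blast
    then show ?thesis using clen_Suc_less[of n] clen_pos[of "Suc n"] by linarith
  next
    case 2
    then show ?thesis using *[of b] cstep_bounds(1)[of n] by linarith
  qed
qed simp

lemma capprox_Suc_subset: "capprox \<xi> k (Suc n) \<subseteq> capprox \<xi> k n"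
proof
  fix x assume "x \<in> capprox \<xi> k (Suc n)"
  then obtain a where a: "a \<in> coffsets \<xi> k (Suc n)" "a \<le> x" "x \<le> a + clen \<xi> (Suc (k + n))"
    by (auto simp: capprox_def)
  from a(1) consider "a \<in> coffsets \<xi> k n"
    | b where "b \<in> coffsets \<xi> k n" "a = b + cstep \<xi> (k + n)" by auto
  then show "x \<in> capprox \<xi> k n"
  proof cases
    case 1
    then have "x \<in> {a..a + clen \<xi> (k + n)}"
      using a clen_Suc_less[of "k + n"] clen_pos[of "Suc (k + n)"] by auto
    then show ?thesis using 1 unfolding capprox_def by blast
  next
    case 2
    then have "x \<in> {b..b + clen \<xi> (k + n)}"
      using a cstep_bounds(3)[of "k + n"] by (auto simp: cstep_def)
    then show ?thesis using 2 unfolding capprox_def by blast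
  qed
qed

lemma decseq_capprox: "decseq (capprox \<xi> k)"
  using capprox_Suc_subset by (intro decseq_SucI) auto

lemma capprox_subset: "capprox \<xi> k n \<subseteq> {0..clen \<xi> k}"
  using decseqD[OF decseq_capprox, of 0 n k] by (simp add: capprox_def)

lemma ctail_subset: "ctail \<xi> k \<subseteq> {0..clen \<xi> k}"
  unfolding ctail_def using capprox_subset by blast

text \<open>An intersection of unions need not be the union of the intersections. Here the
  approximations decrease, so a point that leaves the left half at level \<open>n0\<close> lies in
  the right half at every deeper level, hence at all levels.\<close>

lemma ctail_head: "ctail \<xi> k = ctail \<xi> (Suc k) \<union> (\<lambda>x. x + cstep \<xi> k) ` ctail \<xi> (Suc k)"
proof (intro subset_antisym subsetI)
  fix x assume x: "x \<in> ctail \<xi> k"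
  show "x \<in> ctail \<xi> (Suc k) \<union> (\<lambda>x. x + cstep \<xi> k) ` ctail \<xi> (Suc k)"
  proof (cases "x \<in> ctail \<xi> (Suc k)")
    case False
    then obtain n0 where n0: "x \<notin> capprox \<xi> (Suc k) n0" by (auto simp: ctail_def)
    have "x - cstep \<xi> k \<in> capprox \<xi> (Suc k) n" for n
    proof -
      have "x \<notin> capprox \<xi> (Suc k) (max n n0)"
        using n0 decseqD[OF decseq_capprox, of n0 "max n n0" "Suc k"] by auto
      moreover have "x \<in> capprox \<xi> k (Suc (max n n0))"
        using x unfolding ctail_def by blast
      ultimately have "x - cstep \<xi> k \<in> capprox \<xi> (Suc k) (max n n0)"
        by (auto simp: capprox_head)
      then show ?thesis
        using decseqD[OF decseq_capprox, of n "max n n0" "Suc k"] by auto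
    qed
    then have "x - cstep \<xi> k \<in> ctail \<xi> (Suc k)" by (auto simp: ctail_def)
    then show ?thesis by (auto simp: image_iff intro: bexI[of _ "x - cstep \<xi> k"])
  qed simp
next
  fix x assume "x \<in> ctail \<xi> (Suc k) \<union> (\<lambda>x. x + cstep \<xi> k) ` ctail \<xi> (Suc k)"
  then have "x \<in> capprox \<xi> k (Suc n)" for n
    unfolding capprox_head by (auto simp: ctail_def)
  then show "x \<in> ctail \<xi> k"
    using capprox_Suc_subset unfolding ctail_def by blast
qed

lemma ctail_0_eq: "ctail \<xi> 0 = (\<Union>a\<in>coffsets \<xi> 0 n. (\<lambda>x. x + a) ` ctail \<xi> n)"
proof (induction n)
  case (Suc n)
  show ?case
    unfolding Suc ctail_head[of n]
    by (simp add: image_Un image_image UN_Un UN_Un_distrib ac_simps)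
qed simp

text \<open>These are the leftmost and the rightmost level \<open>n\<close> piece of the leftmost
  level \<open>k\<close> piece, the parts that meet when two copies of the latter barely
  overlap.\<close>

lemma ctail_supset:
  assumes "k \<le> n"
  shows "ctail \<xi> n \<subseteq> ctail \<xi> k" "(\<lambda>x. x + (clen \<xi> k - clen \<xi> n)) ` ctail \<xi> n \<subseteq> ctail \<xi> k"
proof -
  have "ctail \<xi> n \<subseteq> ctail \<xi> k \<and> (\<lambda>x. x + (clen \<xi> k - clen \<xi> n)) ` ctail \<xi> n \<subseteq> ctail \<xi> k"
    using assms
  proof (induction n rule: dec_induct)
    case (step n)
    have "(\<lambda>x. x + (clen \<xi> k - clen \<xi> (Suc n))) ` ctail \<xi> (Suc n) =
        (\<lambda>x. x + (clen \<xi> k - clen \<xi> n)) ` (\<lambda>x. x + cstep \<xi> n) ` ctail \<xi> (Suc n)"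
      by (simp add: image_image cstep_def)
    then show ?case using step ctail_head[of n] by blast
  qed simp
  then show "ctail \<xi> n \<subseteq> ctail \<xi> k" "(\<lambda>x. x + (clen \<xi> k - clen \<xi> n)) ` ctail \<xi> n \<subseteq> ctail \<xi> k"
    by auto
qed

section \<open>Measures of the pieces, their overlaps and the central gap\<close>

lemma emeasure_capprox: "emeasure lborel (capprox \<xi> k n) = ennreal (2 ^ n * clen \<xi> (k + n))"
proof (induction n arbitrary: k)
  case 0
  then show ?case using clen_pos[of k] by (simp add: capprox_def)
next
  case (Suc n)
  have *: "0 \<le> x \<and> x \<le> clen \<xi> (Suc k)" if "x \<in> capprox \<xi> (Suc k) n" for x
    using capprox_subset[of "Suc k" n] that by auto
  have "capprox \<xi> (Suc k) n \<inter> (\<lambda>x. x + cstep \<xi> k) ` capprox \<xi> (Suc k) n = {}"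
    using cstep_bounds(1)[of k] by (auto dest!: *)
  then have "emeasure lborel (capprox \<xi> k (Suc n)) =
      emeasure lborel (capprox \<xi> (Suc k) n) + emeasure lborel ((\<lambda>x. x + cstep \<xi> k) ` capprox \<xi> (Suc k) n)"
    unfolding capprox_head by (intro plus_emeasure[symmetric]) (auto intro: sets_shift_borel)
  also have "\<dots> = ennreal (2 ^ n * clen \<xi> (Suc k + n)) + ennreal (2 ^ n * clen \<xi> (Suc k + n))"
    by (simp add: emeasure_lborel_shift Suc)
  also have "\<dots> = ennreal (2 ^ Suc n * clen \<xi> (k + Suc n))"
    using clen_pos[of "k + Suc n"] by (subst ennreal_plus[symmetric]) (auto simp: less_imp_le)
  finally show ?case .
qed

lemma measure_ctail_LIMSEQ: "(\<lambda>n. 2 ^ n * clen \<xi> (k + n)) \<longlonglongrightarrow> measure lborel (ctail \<xi> k)"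
proof -
  have "(\<lambda>n. measure lborel (capprox \<xi> k n)) \<longlonglongrightarrow> measure lborel (ctail \<xi> k)"
    unfolding ctail_def using decseq_capprox
    by (intro Lim_measure_decseq) (auto simp: emeasure_capprox)
  moreover have "measure lborel (capprox \<xi> k n) = 2 ^ n * clen \<xi> (k + n)" for n
    using emeasure_capprox[of k n] clen_pos[of "k + n"] by (simp add: measure_def)
  ultimately show ?thesis by simp
qed

text \<open>Both sides are limits of the same sequence \<open>2 ^ n * clen \<xi> n\<close>, one of
  them read from index \<open>k\<close> on.\<close>

lemma measure_ctail: "2 ^ k * measure lborel (ctail \<xi> k) = measure lborel (ctail \<xi> 0)"
proof -
  have "(\<lambda>n. 2 ^ k * (2 ^ n * clen \<xi> (k + n))) \<longlonglongrightarrow> 2 ^ k * measure lborel (ctail \<xi> k)"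
    by (intro tendsto_intros measure_ctail_LIMSEQ)
  moreover have "(\<lambda>n. 2 ^ (n + k) * clen \<xi> (0 + (n + k))) \<longlonglongrightarrow> measure lborel (ctail \<xi> 0)"
    using LIMSEQ_ignore_initial_segment[OF measure_ctail_LIMSEQ, of k 0] by simp
  then have "(\<lambda>n. 2 ^ k * (2 ^ n * clen \<xi> (k + n))) \<longlonglongrightarrow> measure lborel (ctail \<xi> 0)"
    by (simp add: power_add ac_simps)
  ultimately show ?thesis by (rule LIMSEQ_unique)
qed

lemma clen_LIMSEQ_0: "clen \<xi> \<longlonglongrightarrow> 0"
proof -
  have "(\<lambda>n. (1 / 2) ^ n * (2 ^ n * clen \<xi> (0 + n))) \<longlonglongrightarrow> 0 * measure lborel (ctail \<xi> 0)"
    by (intro tendsto_mult measure_ctail_LIMSEQ LIMSEQ_realpow_zero) auto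
  then show ?thesis by (simp add: power_divide)
qed

lemma emeasure_ctail_finite: "emeasure lborel (ctail \<xi> k) < \<infinity>"
proof -
  have "emeasure lborel (ctail \<xi> k) \<le> emeasure lborel {0..clen \<xi> k}"
    by (intro emeasure_mono ctail_subset) auto
  also have "\<dots> < \<infinity>" by (simp add: emeasure_lborel_Icc_eq)
  finally show ?thesis .
qed

lemma measure_ctail_le: "measure lborel (ctail \<xi> k) \<le> clen \<xi> k"
proof -
  have "measure lborel (ctail \<xi> k) \<le> measure lborel {0..clen \<xi> k}"
    by (intro measure_mono_fmeasurable ctail_subset)
       (auto simp: fmeasurable_def emeasure_lborel_Icc_eq)
  then show ?thesis using clen_pos[of k] by simp
qed

lemma measure_ctail_Suc: "measure lborel (ctail \<xi> k) = 2 * measure lborel (ctail \<xi> (Suc k))"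
proof -
  have "2 ^ k * measure lborel (ctail \<xi> k) = 2 ^ k * (2 * measure lborel (ctail \<xi> (Suc k)))"
    using measure_ctail[of k] measure_ctail[of "Suc k"] by simp
  then show ?thesis unfolding mult_cancel_left by simp
qed

text \<open>
  The rightmost and the leftmost level \<open>n\<close> pieces overlap in an interval of the same length \<open>t\<close> as
  the level \<open>k\<close> pieces do.  Taking \<open>n\<close> so that \<open>t\<close> is comparable with the length of the pieces, the
  two of them are too dense to be disjoint.
\<close>

lemma ctail_overlap:
  assumes dense: "\<And>n. k \<le> n \<Longrightarrow> 5 * clen \<xi> n \<le> 6 * measure lborel (ctail \<xi> n)"
    and z: "0 \<le> z" "z < clen \<xi> k"
  shows "clen \<xi> k - z \<le> 12 * measure lborel (ctail \<xi> k \<inter> (\<lambda>x. x + z) ` ctail \<xi> k)"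
proof -
  define t where "t = clen \<xi> k - z"
  have t: "0 < t" "t \<le> clen \<xi> k" using z by (auto simp: t_def)
  have "\<exists>n\<ge>k. clen \<xi> (Suc n) < t \<and> t \<le> clen \<xi> n"
  proof (rule ccontr)
    assume neg: "\<not> ?thesis"
    have "t \<le> clen \<xi> n" if "k \<le> n" for n
      using that
    proof (induction n rule: dec_induct)
      case (step n) then show ?case using neg by force
    qed (use t in simp)
    then have "t \<le> 0"
      using clen_LIMSEQ_0 by (intro LIMSEQ_le_const[of "clen \<xi>" 0 t]) auto
    then show False using t by simp
  qed
  then obtain n where n: "k \<le> n" "clen \<xi> (Suc n) < t" "t \<le> clen \<xi> n" by blast
  define A where "A = (\<lambda>x. x + (clen \<xi> k - clen \<xi> n)) ` ctail \<xi> n"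
  define B where "B = (\<lambda>x. x + z) ` ctail \<xi> n"
  have AB [measurable]: "A \<in> sets borel" "B \<in> sets borel"
    unfolding A_def B_def by (auto intro: sets_shift_borel)
  have sub: "A \<subseteq> ctail \<xi> k" "B \<subseteq> (\<lambda>x. x + z) ` ctail \<xi> k"
    unfolding A_def B_def using ctail_supset[OF n(1)] by auto
  have m: "measure lborel A = measure lborel (ctail \<xi> n)" "measure lborel B = measure lborel (ctail \<xi> n)"
    unfolding A_def B_def by (simp_all add: measure_lborel_shift)
  have e: "emeasure lborel A < \<infinity>" "emeasure lborel B < \<infinity>"
    unfolding A_def B_def using emeasure_ctail_finite by (simp_all add: emeasure_lborel_shift)
  have "A \<union> B \<subseteq> {clen \<xi> k - clen \<xi> n .. z + clen \<xi> n}"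
    using ctail_subset[of n] n by (auto simp: A_def B_def t_def) 
  then have "measure lborel (A \<union> B) \<le> measure lborel {clen \<xi> k - clen \<xi> n .. z + clen \<xi> n}"
    by (intro measure_mono_fmeasurable) (auto simp: fmeasurable_def emeasure_lborel_Icc_eq)
  also have "\<dots> = 2 * clen \<xi> n - t"
    using n clen_pos[of n] by (simp add: t_def)
  finally have U: "measure lborel (A \<union> B) \<le> 2 * clen \<xi> n - t" .
  have "measure lborel (A \<union> B) = measure lborel A + measure lborel B - measure lborel (A \<inter> B)"
    using e by (intro measure_Un3) (auto simp: fmeasurable_def)
  moreover have "measure lborel (A \<inter> B) \<le> measure lborel (ctail \<xi> k \<inter> (\<lambda>x. x + z) ` ctail \<xi> k)"
    using sub emeasure_ctail_finite[of k]
    by (intro measure_mono_fmeasurable fmeasurable_Int_fmeasurable)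
       (auto simp: fmeasurable_def intro: sets_shift_borel)
  \<comment> \<open>Write L for \<open>clen \<xi> n\<close>. The density gives |A Int B| \<ge> t - L
    / 3, which is useful only if L is at most a bounded multiple of t. Now L \<le> (6/5) * 2 *
    \<open>clen \<xi> (Suc n)\<close> < (12/5) t, so |A Int B| is at least t / 5, more than the
    claimed t / 12.\<close>
  moreover have "measure lborel (ctail \<xi> n) \<le> 2 * clen \<xi> (Suc n)"
    using measure_ctail_Suc[of n] measure_ctail_le[of "Suc n"] by simp
  ultimately show ?thesis
    using U m n dense[OF n(1)] unfolding t_def[symmetric] by linarith
qed

lemma ctail_overlap_abs:
  assumes dense: "\<And>n. k \<le> n \<Longrightarrow> 5 * clen \<xi> n \<le> 6 * measure lborel (ctail \<xi> n)"
    and z: "\<bar>z\<bar> < clen \<xi> k"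
  shows "clen \<xi> k - \<bar>z\<bar> \<le> 12 * measure lborel (ctail \<xi> k \<inter> (\<lambda>x. x + z) ` ctail \<xi> k)"
proof (cases "0 \<le> z")
  case True
  then show ?thesis using ctail_overlap[of k z] assms by simp
next
  case False
  then show ?thesis
    using ctail_overlap[of k "- z"] assms measure_lborel_Int_shift[OF sets_ctail, of \<xi> k z] by simp
qed

text \<open>The open interval is the central gap of the leftmost level \<open>k\<close> piece,
  trimmed on both sides. If a translate of the set enters it, some translated level \<open>k\<close>
  piece has a hull that overlaps the hull of the leftmost piece in length at least \<open>u\<close>.
  So the right-hand measure is bounded below, while the left one never exceeds
  \<open>q - p\<close>.\<close>

lemma ctail_gap:
  assumes pos: "0 < measure lborel (ctail \<xi> 0)"
  obtains p q C \<delta> :: real where "p < q" "0 < C" "0 < \<delta>"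
    "{p<..<q} \<inter> ctail \<xi> 0 = {}"
    "\<And>y. \<bar>y\<bar> < \<delta> \<Longrightarrow> {p<..<q} \<inter> (\<lambda>x. x + y) ` ctail \<xi> 0 = {}"
    "\<And>y. measure lborel ({p<..<q} \<inter> (\<lambda>x. x + y) ` ctail \<xi> 0)
        \<le> C * measure lborel (ctail \<xi> 0 \<inter> (\<lambda>x. x + y) ` ctail \<xi> 0)"
proof -
  let ?E = "ctail \<xi> 0"
  \<comment> \<open>The limit is positive, so the sequence eventually drops below any multiple of it
    with factor above 1; 6 / 5 is the density that \<open>ctail_overlap\<close> asks for.\<close>
  have "\<forall>\<^sub>F n in sequentially. 2 ^ n * clen \<xi> (0 + n) < 6 / 5 * measure lborel ?E"
    using pos by (intro order_tendstoD[OF measure_ctail_LIMSEQ]) auto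
  then obtain k where k: "\<And>n. k \<le> n \<Longrightarrow> 2 ^ n * clen \<xi> n < 6 / 5 * measure lborel ?E"
    by (auto simp: eventually_sequentially)
  have dense: "5 * clen \<xi> n \<le> 6 * measure lborel (ctail \<xi> n)" if "k \<le> n" for n
  proof -
    have "2 ^ n * clen \<xi> n < 2 ^ n * (6 / 5 * measure lborel (ctail \<xi> n))"
      using k[OF that] measure_ctail[of n] by (simp add: mult.left_commute)
    then show ?thesis by (simp add: mult_less_cancel_left)
  qed
  define s u v where "s = clen \<xi> k" and "u = clen \<xi> (Suc k)" and "v = cstep \<xi> k"
  have uv: "0 < u" "u < v" "v = s - u"
    using clen_pos[of "Suc k"] cstep_bounds(1)[of k] by (auto simp: s_def u_def v_def cstep_def)
  define \<delta> where "\<delta> = (v - u) / 4"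
  have \<delta>: "0 < \<delta>" using uv by (simp add: \<delta>_def)
  \<comment> \<open>The trimming serves the translates by less than \<open>\<delta>\<close>: they
    move no point from outside \<open>{u<..<v}\<close> into \<open>{p<..<q}\<close>.\<close>
  define p q where "p = u + \<delta>" and "q = v - \<delta>"
  have pq: "p < q" "u < p" "q < s - u" using uv \<delta> by (auto simp: p_def q_def \<delta>_def field_simps)
  have T: "ctail \<xi> k \<inter> {u<..<v} = {}"
    unfolding ctail_head[of k] using ctail_subset[of "Suc k"] by (fastforce simp: u_def v_def)
  have gap: "x \<notin> ?E" if x: "u < x" "x < v" for x
  proof
    assume "x \<in> ?E"
    then obtain a where a: "a \<in> coffsets \<xi> 0 k" "x - a \<in> ctail \<xi> k"
      unfolding ctail_0_eq[of k] by auto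
    show False
    proof (cases "a = 0")
      case True then show False using a T x by auto
    next
      case False
      then have "s < a" using coffsets_bounds[OF a(1)] by (simp add: s_def)
      moreover have "0 \<le> x - a" using a ctail_subset[of k] by auto
      ultimately show False using x uv by linarith
    qed
  qed
  have fm: "?E \<in> fmeasurable lborel"
    using emeasure_ctail_finite by (auto simp: fmeasurable_def)
  show thesis
  proof
    show "p < q" by fact
    show "0 < 12 * (q - p) / u" using pq uv by simp
    show "0 < \<delta>" by fact
    show "{p<..<q} \<inter> ?E = {}" using gap \<delta> by (auto simp: p_def q_def)
    show "{p<..<q} \<inter> (\<lambda>x. x + y) ` ?E = {}" if y: "\<bar>y\<bar> < \<delta>" for y
    proof -
      have "u < x \<and> x < v" if "p < x + y" "x + y < q" for x
        using y that by (auto simp: p_def q_def)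
      then show ?thesis using gap by auto
    qed
    show "measure lborel ({p<..<q} \<inter> (\<lambda>x. x + y) ` ?E)
        \<le> 12 * (q - p) / u * measure lborel (?E \<inter> (\<lambda>x. x + y) ` ?E)" for y
    proof (cases "{p<..<q} \<inter> (\<lambda>x. x + y) ` ?E = {}")
      case False
      then obtain x' where "x' \<in> ?E" "p < x' + y" "x' + y < q" by auto
      then obtain x where x: "p < x" "x < q" "x - y \<in> ?E"
        by (metis add_diff_cancel_right')
      then obtain a where a: "a \<in> coffsets \<xi> 0 k" "x - y - a \<in> ctail \<xi> k"
        unfolding ctail_0_eq[of k] by auto
      then have "0 \<le> x - y - a" "x - y - a \<le> s" using ctail_subset[of k] by (auto simp: s_def)
      \<comment> \<open>The moved hull \<open>{a + y..a + y + s}\<close> contains x, and u < x < s -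
        u; hence it is shifted from \<open>{0..s}\<close> by at most s - u in either
        direction.\<close>
      then have z: "\<bar>a + y\<bar> \<le> s - u" using x pq uv by auto
      have "u \<le> s - \<bar>a + y\<bar>" using z by simp
      also have "\<dots> \<le> 12 * measure lborel (ctail \<xi> k \<inter> (\<lambda>x. x + (a + y)) ` ctail \<xi> k)"
        unfolding s_def using z uv by (intro ctail_overlap_abs dense) (auto simp: s_def)
      also have "measure lborel (ctail \<xi> k \<inter> (\<lambda>x. x + (a + y)) ` ctail \<xi> k)
          \<le> measure lborel (?E \<inter> (\<lambda>x. x + y) ` ?E)"
      proof (rule measure_mono_fmeasurable)
        have "(\<lambda>x. x + a) ` ctail \<xi> k \<subseteq> ?E" using a(1) unfolding ctail_0_eq[of k] by blast
        moreover have "(\<lambda>x. x + (a + y)) ` ctail \<xi> k = (\<lambda>x. x + y) ` (\<lambda>x. x + a) ` ctail \<xi> k"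
          by (simp add: image_image ac_simps)
        ultimately show "ctail \<xi> k \<inter> (\<lambda>x. x + (a + y)) ` ctail \<xi> k \<subseteq> ?E \<inter> (\<lambda>x. x + y) ` ?E"
          using ctail_supset(1)[of 0 k] by blast
        show "ctail \<xi> k \<inter> (\<lambda>x. x + (a + y)) ` ctail \<xi> k \<in> sets lborel"
          by (auto intro: sets_shift_borel)
        show "?E \<inter> (\<lambda>x. x + y) ` ?E \<in> fmeasurable lborel"
          using fm by (intro fmeasurable_Int_fmeasurable) (auto intro: sets_shift_borel)
      qed
      finally have w: "u \<le> 12 * measure lborel (?E \<inter> (\<lambda>x. x + y) ` ?E)" by simp
      have "measure lborel ({p<..<q} \<inter> (\<lambda>x. x + y) ` ?E) \<le> measure lborel {p<..<q}"
        using pq by (intro measure_mono_fmeasurable) (auto simp: fmeasurable_def intro: sets_shift_borel)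
      also have "\<dots> = (q - p) / u * u" using pq uv by simp
      also have "\<dots> \<le> (q - p) / u * (12 * measure lborel (?E \<inter> (\<lambda>x. x + y) ` ?E))"
        using w pq uv by (intro mult_left_mono) auto
      finally show ?thesis by (simp only: times_divide_eq_left times_divide_eq_right mult_ac)
    qed (use pq uv in simp)
  qed
qed

end

section \<open>Weak tilings\<close>

text \<open>Carries estimates for finite subsets, such as Bessel's inequality or a count of
  separated points, over to sums over a countable set.\<close>

lemma nn_integral_count_space_le:
  fixes f :: "'a \<Rightarrow> ennreal"
  assumes "countable X" and fin: "\<And>F. finite F \<Longrightarrow> F \<subseteq> X \<Longrightarrow> sum f F \<le> B"
  shows "(\<integral>\<^sup>+ x. f x \<partial>count_space X) \<le> B"
proof (cases "finite X")
  case True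
  then show ?thesis using fin by (simp add: nn_integral_count_space_finite)
next
  case False
  let ?g = "from_nat_into X"
  have bij: "bij_betw ?g UNIV X"
    using assms(1) False by (rule bij_betw_from_nat_into)
  have "(\<integral>\<^sup>+ x. f x \<partial>count_space X) = (\<integral>\<^sup>+ n. f (?g n) \<partial>count_space UNIV)"
    by (rule nn_integral_bij_count_space[OF bij, symmetric])
  also have "\<dots> = (\<Sum>n. f (?g n))"
    by (rule nn_integral_count_space_nat)
  also have "\<dots> \<le> B"
  proof (rule suminf_le_const)
    fix n
    have "inj_on ?g {..<n}"
      using bij by (auto simp: bij_betw_def intro: inj_on_subset)
    then have "(\<Sum>i<n. f (?g i)) = sum f (?g ` {..<n})"
      by (simp only: sum.reindex comp_def)
    also have "\<dots> \<le> B"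
      using bij by (intro fin) (auto simp only: bij_betw_def finite_imageI finite_lessThan)
    finally show "(\<Sum>i<n. f (?g i)) \<le> B" .
  qed simp
  finally show ?thesis .
qed

text \<open>Makes Fubini available for the tiling measure. By Lindelof, countably many of the open
  sets of finite mass already cover the space.\<close>

lemma locally_finite_borel_sigma_finite:
  fixes \<nu> :: "'a::euclidean_space measure"
  assumes "locally_finite_borel \<nu>"
  shows "sigma_finite_measure \<nu>"
proof -
  have sets: "sets \<nu> = sets borel" and fin: "\<forall>x. \<exists>U. open U \<and> x \<in> U \<and> emeasure \<nu> U < \<infinity>"
    using assms by (auto simp: locally_finite_borel_def)
  define \<U> where "\<U> = {U. open U \<and> emeasure \<nu> U < \<infinity>}"
  have "\<And>U. U \<in> \<U> \<Longrightarrow> open U" by (simp add: \<U>_def)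
  from Lindelof[OF this] obtain \<V> where \<V>: "\<V> \<subseteq> \<U>" "countable \<V>" "\<Union>\<V> = \<Union>\<U>"
    by blast
  have "x \<in> \<Union>\<U>" for x
  proof -
    obtain U where "open U" "x \<in> U" "emeasure \<nu> U < \<infinity>" using fin by blast
    then show ?thesis by (intro UnionI[of U]) (simp_all add: \<U>_def)
  qed
  then have U: "\<Union>\<U> = UNIV" by blast
  show ?thesis
  proof (intro sigma_finite_measure.intro exI conjI ballI)
    show "countable \<V>" by fact
    show "\<V> \<subseteq> sets \<nu>" using \<V>(1) by (auto simp: \<U>_def sets)
    show "\<Union>\<V> = space \<nu>" using \<V>(3) U sets_eq_imp_space_eq[OF sets] by simp
    show "emeasure \<nu> V \<noteq> \<infinity>" if "V \<in> \<V>" for V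
      using \<V>(1) that by (auto simp: \<U>_def)
  qed
qed

lemma emeasure_Int_shift:
  fixes A E :: "real set"
  assumes [measurable]: "A \<in> sets borel" "E \<in> sets borel"
  shows "emeasure lborel (A \<inter> (\<lambda>x. x + y) ` E) = (\<integral>\<^sup>+ x. indicator A x * indicator E (x - y) \<partial>lborel)"
proof -
  have "A \<inter> (\<lambda>x. x + y) ` E = {x \<in> A. x - y \<in> E}"
    by (auto simp: image_iff) (metis diff_add_cancel)
  then have "emeasure lborel (A \<inter> (\<lambda>x. x + y) ` E) = (\<integral>\<^sup>+ x. indicator {x \<in> A. x - y \<in> E} x \<partial>lborel)"
    by simp
  also have "\<dots> = (\<integral>\<^sup>+ x. indicator A x * indicator E (x - y) \<partial>lborel)"
    by (intro nn_integral_cong) (simp add: indicator_def)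
  finally show ?thesis .
qed

lemma measurable_emeasure_Int_shift:
  fixes A E :: "real set"
  assumes [measurable]: "A \<in> sets borel" "E \<in> sets borel"
  shows "(\<lambda>y. emeasure lborel (A \<inter> (\<lambda>x. x + y) ` E)) \<in> borel_measurable borel"
  unfolding emeasure_Int_shift[OF assms] by measurable

text \<open>Tonelli, with a weight so that one identity serves both the tiling measure
  (\<open>\<phi>\<close> constant 1) and measures with a density with respect to Lebesgue
  measure.\<close>

lemma nn_integral_indicator_convolution:
  fixes A E :: "real set"
  assumes "sigma_finite_measure \<nu>" and sets_\<nu> [measurable_cong]: "sets \<nu> = sets borel"
    and [measurable]: "A \<in> sets borel" "E \<in> sets borel" "\<phi> \<in> borel_measurable borel"
  shows "(\<integral>\<^sup>+ x. indicator A x * (\<integral>\<^sup>+ y. indicator E (x - y) * \<phi> y \<partial>\<nu>) \<partial>lborel)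
    = (\<integral>\<^sup>+ y. \<phi> y * emeasure lborel (A \<inter> (\<lambda>x. x + y) ` E) \<partial>\<nu>)"
proof -
  interpret N: sigma_finite_measure \<nu> by fact
  interpret P: pair_sigma_finite \<nu> lborel ..
  have "(\<integral>\<^sup>+ x. indicator A x * (\<integral>\<^sup>+ y. indicator E (x - y) * \<phi> y \<partial>\<nu>) \<partial>lborel)
      = (\<integral>\<^sup>+ x. (\<integral>\<^sup>+ y. indicator A x * (indicator E (x - y) * \<phi> y) \<partial>\<nu>) \<partial>lborel)"
    by (intro nn_integral_cong nn_integral_cmult[symmetric]) measurable
  also have "\<dots> = (\<integral>\<^sup>+ y. (\<integral>\<^sup>+ x. indicator A x * (indicator E (x - y) * \<phi> y) \<partial>lborel) \<partial>\<nu>)"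
    by (rule P.Fubini') measurable
  also have "\<dots> = (\<integral>\<^sup>+ y. \<phi> y * emeasure lborel (A \<inter> (\<lambda>x. x + y) ` E) \<partial>\<nu>)"
  proof (rule nn_integral_cong)
    fix y
    have "(\<integral>\<^sup>+ x. indicator A x * (indicator E (x - y) * \<phi> y) \<partial>lborel)
        = (\<integral>\<^sup>+ x. (indicator A x * indicator E (x - y)) * \<phi> y \<partial>lborel)"
      by (simp only: mult.assoc)
    also have "\<dots> = (\<integral>\<^sup>+ x. indicator A x * indicator E (x - y) \<partial>lborel) * \<phi> y"
      by (rule nn_integral_multc) measurable
    finally show "(\<integral>\<^sup>+ x. indicator A x * (indicator E (x - y) * \<phi> y) \<partial>lborel)
        = \<phi> y * emeasure lborel (A \<inter> (\<lambda>x. x + y) ` E)"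
      by (simp only: emeasure_Int_shift[OF assms(3,4)] mult.commute)
  qed
  finally show ?thesis .
qed

lemma not_weakly_tiles_complement:
  fixes E G :: "real set"
  assumes [measurable]: "E \<in> sets borel" "G \<in> sets borel"
    and "G \<inter> E = {}" "0 < emeasure lborel G"
    and dom: "\<And>y. emeasure lborel (G \<inter> (\<lambda>x. x + y) ` E) \<le> ennreal C * emeasure lborel (E \<inter> (\<lambda>x. x + y) ` E)"
  shows "\<not> weakly_tiles E (UNIV - E)"
proof
  assume "weakly_tiles E (UNIV - E)"
  then obtain \<nu> where lf: "locally_finite_borel \<nu>"
    and conv: "AE x in lebesgue. indicator_convolution E \<nu> x = indicator (UNIV - E) x"
    by (auto simp: weakly_tiles_def)
  have sets_\<nu> [measurable_cong]: "sets \<nu> = sets borel"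
    using lf by (simp add: locally_finite_borel_def)
  have sf: "sigma_finite_measure \<nu>" using lf by (rule locally_finite_borel_sigma_finite)
  \<comment> \<open>The tiling identity tested against A. For A = E the value is 0, and domination
    passes this on to G, for which the value is |G| > 0.\<close>
  have *: "(\<integral>\<^sup>+ y. emeasure lborel (A \<inter> (\<lambda>x. x + y) ` E) \<partial>\<nu>) = emeasure lborel (A - E)"
    if [measurable]: "A \<in> sets borel" for A
  proof -
    have "(\<integral>\<^sup>+ y. emeasure lborel (A \<inter> (\<lambda>x. x + y) ` E) \<partial>\<nu>)
       = (\<integral>\<^sup>+ x. indicator A x * indicator_convolution E \<nu> x \<partial>lborel)"
      using nn_integral_indicator_convolution[OF sf sets_\<nu>, of A E "\<lambda>_. 1"]
      by (simp add: indicator_convolution_def)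
    also have "\<dots> = (\<integral>\<^sup>+ x. indicator A x * indicator_convolution E \<nu> x \<partial>lebesgue)"
      by (simp add: nn_integral_completion)
    also have "\<dots> = (\<integral>\<^sup>+ x. indicator (A - E) x \<partial>lebesgue)"
      by (rule nn_integral_cong_AE) (use conv in \<open>auto simp: indicator_def\<close>)
    also have "\<dots> = (\<integral>\<^sup>+ x. indicator (A - E) x \<partial>lborel)"
      by (simp add: nn_integral_completion)
    also have "\<dots> = emeasure lborel (A - E)" by simp
    finally show ?thesis .
  qed
  have ms: "(\<lambda>y. emeasure lborel (E \<inter> (\<lambda>x. x + y) ` E)) \<in> borel_measurable \<nu>"
    using measurable_emeasure_Int_shift[of E E] by measurable
  have "emeasure lborel G = emeasure lborel (G - E)"
    using assms(3) by (simp add: Diff_triv)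
  also have "\<dots> = (\<integral>\<^sup>+ y. emeasure lborel (G \<inter> (\<lambda>x. x + y) ` E) \<partial>\<nu>)"
    by (simp add: *)
  also have "\<dots> \<le> (\<integral>\<^sup>+ y. ennreal C * emeasure lborel (E \<inter> (\<lambda>x. x + y) ` E) \<partial>\<nu>)"
    by (intro nn_integral_mono dom)
  also have "\<dots> = ennreal C * (\<integral>\<^sup>+ y. emeasure lborel (E \<inter> (\<lambda>x. x + y) ` E) \<partial>\<nu>)"
    by (rule nn_integral_cmult[OF ms])
  also have "\<dots> = 0" using *[of E] by simp
  finally show False using assms(4) by simp
qed

section \<open>Orthogonal exponentials\<close>

lemma expo_add: "expo (a + b) x = expo a x * expo b x"
  by (simp add: expo_def inner_add_left ring_distribs exp_add)

lemma expo_diff_right: "expo a (x - y) = expo a x * expo (- a) y"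
  by (simp add: expo_def inner_diff_right ring_distribs exp_diff exp_minus divide_inverse)

lemma cnj_expo: "cnj (expo a x) = expo (- a) x"
  by (simp add: expo_def exp_cnj)

lemma expo_0 [simp]: "expo 0 x = 1"
  by (simp add: expo_def)

lemma expo_real_cis: "expo a x = cis (2 * pi * (a * x))" for a x :: real
  by (simp add: expo_def cis_conv_exp mult_ac)

lemma norm_expo [simp]: "cmod (expo a x) = 1"
  by (simp add: expo_def norm_exp_eq_Re)

lemma expo_measurable [measurable (raw)]:
  fixes f g :: "'a \<Rightarrow> real"
  assumes [measurable]: "f \<in> borel_measurable M" "g \<in> borel_measurable M"
  shows "(\<lambda>x. expo (f x) (g x)) \<in> borel_measurable M"
  unfolding expo_def by measurable

lemma cnj_measurable [measurable (raw)]: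
  "f \<in> borel_measurable M \<Longrightarrow> (\<lambda>x. cnj (f x)) \<in> borel_measurable M"
  by (rule measurable_compose[OF _ borel_measurable_continuous_onI]) (auto intro: continuous_intros)

text \<open>Stated for a general finite measure because it serves twice: for integer frequencies on
  the unit interval and for the spectrum on E. The bounds by 1 give integrability; \<open>V\<close>
  is the common squared norm of the system.\<close>

lemma (in finite_measure) integral_square_orthogonal_expansion:
  fixes \<phi> :: "'a \<Rightarrow> complex" and e :: "'i \<Rightarrow> 'a \<Rightarrow> complex"
  assumes [measurable]: "\<phi> \<in> borel_measurable M" "\<And>i. e i \<in> borel_measurable M"
    and bounded: "\<And>x. cmod (\<phi> x) \<le> 1" "\<And>i x. cmod (e i x) \<le> 1"
    and F: "finite F"
    and orth: "\<And>i j. i \<in> F \<Longrightarrow> j \<in> F \<Longrightarrow> (LINT x|M. e i x * cnj (e j x)) = (if i = j then of_real V else 0)"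
  shows "(LINT x|M. (cmod (\<phi> x - (\<Sum>i\<in>F. c i * e i x)))\<^sup>2) = (LINT x|M. (cmod (\<phi> x))\<^sup>2)
     - (\<Sum>i\<in>F. 2 * Re (cnj (c i) * (LINT x|M. \<phi> x * cnj (e i x)))) + V * (\<Sum>i\<in>F. (cmod (c i))\<^sup>2)"
proof -
  have int1: "integrable M (\<lambda>x. \<phi> x * cnj (e i x))" for i
    by (rule integrable_const_bound[of _ 1]) (auto simp: norm_mult intro!: mult_le_one bounded AE_I2)
  have int2: "integrable M (\<lambda>x. e i x * cnj (e j x))" for i j
    by (rule integrable_const_bound[of _ 1]) (auto simp: norm_mult intro!: mult_le_one bounded AE_I2)
  have int3: "integrable M (\<lambda>x. (cmod (\<phi> x))\<^sup>2)"
    by (rule integrable_const_bound[of _ 1]) (auto intro!: power_le_one bounded AE_I2)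
  have eq: "(cmod (\<phi> x - (\<Sum>i\<in>F. c i * e i x)))\<^sup>2 = (cmod (\<phi> x))\<^sup>2
     - (\<Sum>i\<in>F. 2 * Re (cnj (c i) * (\<phi> x * cnj (e i x))))
     + (\<Sum>i\<in>F. \<Sum>j\<in>F. Re (c i * cnj (c j) * (e i x * cnj (e j x))))" for x
  proof -
    let ?s = "\<Sum>i\<in>F. c i * e i x"
    have "(cmod (a - b))\<^sup>2 = (cmod a)\<^sup>2 - 2 * Re (a * cnj b) + Re (b * cnj b)" for a b
      unfolding cmod_power2 by (simp add: power2_eq_square algebra_simps)
    then have "(cmod (\<phi> x - ?s))\<^sup>2 = (cmod (\<phi> x))\<^sup>2 - 2 * Re (\<phi> x * cnj ?s) + Re (?s * cnj ?s)" .
    moreover have "2 * Re (\<phi> x * cnj ?s) = (\<Sum>i\<in>F. 2 * Re (cnj (c i) * (\<phi> x * cnj (e i x))))"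
      by (simp only: cnj_sum sum_distrib_left complex_cnj_mult Re_sum mult_ac)
    moreover have "Re (?s * cnj ?s) = (\<Sum>i\<in>F. \<Sum>j\<in>F. Re (c i * cnj (c j) * (e i x * cnj (e j x))))"
      by (simp only: cnj_sum sum_product complex_cnj_mult Re_sum mult_ac)
    ultimately show ?thesis by simp
  qed
  have "(LINT x|M. (cmod (\<phi> x - (\<Sum>i\<in>F. c i * e i x)))\<^sup>2) = (LINT x|M. (cmod (\<phi> x))\<^sup>2)
     - (\<Sum>i\<in>F. 2 * Re (cnj (c i) * (LINT x|M. \<phi> x * cnj (e i x))))
     + (\<Sum>i\<in>F. \<Sum>j\<in>F. Re (c i * cnj (c j) * (LINT x|M. e i x * cnj (e j x))))"
  proof -
    have 1: "integrable M (\<lambda>x. \<Sum>i\<in>F. 2 * Re (cnj (c i) * (\<phi> x * cnj (e i x))))"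
      by (intro Bochner_Integration.integrable_sum integrable_mult_right integrable_Re int1)
    have 2: "integrable M (\<lambda>x. \<Sum>i\<in>F. \<Sum>j\<in>F. Re (c i * cnj (c j) * (e i x * cnj (e j x))))"
      by (intro Bochner_Integration.integrable_sum integrable_mult_right integrable_Re int2)
    have 3: "(LINT x|M. Re (k * f x)) = Re (k * (LINT x|M. f x))" if "integrable M f" for k f
      by (subst integral_Re) (simp_all add: that integrable_mult_right del: times_complex.sel)
    have 4: "(LINT x|M. (\<Sum>i\<in>F. 2 * Re (cnj (c i) * (\<phi> x * cnj (e i x)))))
        = (\<Sum>i\<in>F. 2 * Re (cnj (c i) * (LINT x|M. \<phi> x * cnj (e i x))))"
      by (subst Bochner_Integration.integral_sum)
         (simp_all only: integral_mult_right_zero 3[OF int1] integrable_mult_right integrable_Re int1)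
    have 5: "(LINT x|M. (\<Sum>i\<in>F. \<Sum>j\<in>F. Re (c i * cnj (c j) * (e i x * cnj (e j x)))))
        = (\<Sum>i\<in>F. \<Sum>j\<in>F. Re (c i * cnj (c j) * (LINT x|M. e i x * cnj (e j x))))"
      by (subst Bochner_Integration.integral_sum, (intro Bochner_Integration.integrable_sum integrable_mult_right integrable_Re int2)[1],
          intro sum.cong refl, subst Bochner_Integration.integral_sum)
         (simp_all only: 3[OF int2] integrable_mult_right integrable_Re int2)
    show ?thesis
      unfolding eq using 1 2 int3 by (simp only: 4 5 Bochner_Integration.integral_add Bochner_Integration.integral_diff
          Bochner_Integration.integrable_diff)
  qed
  also have "(\<Sum>i\<in>F. \<Sum>j\<in>F. Re (c i * cnj (c j) * (LINT x|M. e i x * cnj (e j x))))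
     = (\<Sum>i\<in>F. \<Sum>j\<in>F. if i = j then V * (cmod (c i))\<^sup>2 else 0)"
  proof (intro sum.cong refl)
    fix i j assume "i \<in> F" "j \<in> F"
    moreover have "Re (d * cnj d * of_real V) = V * (cmod d)\<^sup>2" for d
      unfolding cmod_power2 by (simp add: power2_eq_square algebra_simps)
    ultimately show "Re (c i * cnj (c j) * (LINT x|M. e i x * cnj (e j x)))
        = (if i = j then V * (cmod (c i))\<^sup>2 else 0)"
      by (simp add: orth del: times_complex.sel)
  qed
  also have "\<dots> = V * (\<Sum>i\<in>F. (cmod (c i))\<^sup>2)"
    using F by (simp add: sum_distrib_left)
  finally show ?thesis .
qed

lemma two_Re_cnj_mult_le:
  assumes "0 < V"
  shows "2 * Re (cnj c * b) \<le> (cmod b)\<^sup>2 / V + V * (cmod c)\<^sup>2"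
proof -
  have "0 \<le> (cmod (b - of_real V * c))\<^sup>2 / V" using assms by simp
  also have "\<dots> = (cmod b)\<^sup>2 / V + V * (cmod c)\<^sup>2 - 2 * Re (cnj c * b)"
    unfolding cmod_power2 using assms by (simp add: power2_eq_square field_simps)
  finally show ?thesis by simp
qed

text \<open>Completeness supplies approximations with unknown coefficients. Completing the square in
  each coefficient shows that the Fourier coefficients do at least as well, so the approximation
  error bounds the Bessel defect. Inserting the Fourier coefficients themselves gives Bessel's
  inequality.\<close>

lemma (in finite_measure)
  fixes \<phi> :: "'a \<Rightarrow> complex" and e :: "'i \<Rightarrow> 'a \<Rightarrow> complex"
  assumes [measurable]: "\<phi> \<in> borel_measurable M" "\<And>i. e i \<in> borel_measurable M"
    and bounded: "\<And>x. cmod (\<phi> x) \<le> 1" "\<And>i x. cmod (e i x) \<le> 1"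
    and F: "finite F" and V: "0 < V"
    and orth: "\<And>i j. i \<in> F \<Longrightarrow> j \<in> F \<Longrightarrow> (LINT x|M. e i x * cnj (e j x)) = (if i = j then of_real V else 0)"
  shows Bessel_approximation: "(LINT x|M. (cmod (\<phi> x))\<^sup>2) - (\<Sum>i\<in>F. (cmod (LINT x|M. \<phi> x * cnj (e i x)))\<^sup>2) / V
      \<le> (LINT x|M. (cmod (\<phi> x - (\<Sum>i\<in>F. c i * e i x)))\<^sup>2)"
    and Bessel_inequality: "(\<Sum>i\<in>F. (cmod (LINT x|M. \<phi> x * cnj (e i x)))\<^sup>2) \<le> V * (LINT x|M. (cmod (\<phi> x))\<^sup>2)"
proof -
  note exp = integral_square_orthogonal_expansion[OF assms(1-5) orth]
  let ?b = "\<lambda>i. LINT x|M. \<phi> x * cnj (e i x)"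
  have "(\<Sum>i\<in>F. 2 * Re (cnj (c i) * ?b i)) \<le> (\<Sum>i\<in>F. (cmod (?b i))\<^sup>2 / V + V * (cmod (c i))\<^sup>2)"
    using V by (intro sum_mono two_Re_cnj_mult_le)
  then show "(LINT x|M. (cmod (\<phi> x))\<^sup>2) - (\<Sum>i\<in>F. (cmod (?b i))\<^sup>2) / V
      \<le> (LINT x|M. (cmod (\<phi> x - (\<Sum>i\<in>F. c i * e i x)))\<^sup>2)"
    by (simp add: exp sum.distrib sum_distrib_left sum_divide_distrib)
  have "0 \<le> (LINT x|M. (cmod (\<phi> x - (\<Sum>i\<in>F. ?b i / of_real V * e i x)))\<^sup>2)"
    by simp
  also have "\<dots> = (LINT x|M. (cmod (\<phi> x))\<^sup>2) - (\<Sum>i\<in>F. (cmod (?b i))\<^sup>2) / V"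
  proof -
    have 1: "2 * Re (cnj (b / of_real V) * b) = 2 * ((cmod b)\<^sup>2 / V)"
      and 2: "(cmod (b / of_real V))\<^sup>2 = (cmod b)\<^sup>2 / V / V" for b
      using V by (simp_all only: cmod_power2) (simp_all add: power2_eq_square field_simps)
    have "(\<Sum>i\<in>F. 2 * Re (cnj (?b i / of_real V) * ?b i)) = 2 * ((\<Sum>i\<in>F. (cmod (?b i))\<^sup>2) / V)"
      unfolding 1 by (simp add: sum_distrib_left sum_divide_distrib)
    moreover have "V * (\<Sum>i\<in>F. (cmod (?b i / of_real V))\<^sup>2) = (\<Sum>i\<in>F. (cmod (?b i))\<^sup>2) / V"
      unfolding 2 using V by (simp add: sum_divide_distrib[symmetric])
    ultimately show ?thesis
      using exp[of "\<lambda>i. ?b i / of_real V"] by linarith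
  qed
  finally show "(\<Sum>i\<in>F. (cmod (?b i))\<^sup>2) \<le> V * (LINT x|M. (cmod (\<phi> x))\<^sup>2)"
    using V by (simp add: field_simps)
qed

lemma lebesgue_on_measurable_borel:
  "f \<in> borel_measurable borel \<Longrightarrow> f \<in> borel_measurable (lebesgue_on E)"
  by (intro measurable_restrict_space1 measurable_completion) simp

lemma integral_lebesgue_on_borel:
  fixes f :: "'a::euclidean_space \<Rightarrow> 'b::{banach, second_countable_topology}"
  assumes [measurable]: "E \<in> sets borel" "f \<in> borel_measurable borel"
  shows "(LINT x|lebesgue_on E. f x) = (LINT x|lborel. indicator E x *\<^sub>R f x)"
proof -
  have "(LINT x|lebesgue_on E. f x) = (LINT x|lebesgue. indicator E x *\<^sub>R f x)"
    by (subst integral_restrict_space) auto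
  also have "\<dots> = (LINT x|lborel. indicator E x *\<^sub>R f x)"
    by (rule integral_completion) measurable
  finally show ?thesis .
qed

lemma expo_orthonormal_unit_interval:
  assumes "k \<in> \<int>" "m \<in> \<int>"
  shows "(LINT x|restrict_space lborel {0..1::real}. expo k x * cnj (expo m x)) = (if k = m then 1 else 0)"
proof -
  have "(LINT x|restrict_space lborel {0..1::real}. expo k x * cnj (expo m x))
      = (LINT x|lborel. indicator {0..1} x *\<^sub>R expo (k - m) x)"
    by (subst integral_restrict_space) (simp_all add: cnj_expo expo_add[symmetric])
  also have "\<dots> = (if k = m then 1 else 0)"
  proof (cases "k = m")
    case False
    define c where "c = 2 * of_real pi * \<i> * of_real (k - m)"
    have c: "c \<noteq> 0" using False by (simp add: c_def)
    have ex: "expo (k - m) x = exp (c * of_real x)" for x :: real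
      by (simp add: expo_def c_def mult_ac)
    have "has_bochner_integral lborel (\<lambda>x. indicator {0..1} x *\<^sub>R expo (k - m) x)
        (exp (c * of_real 1) / c - exp (c * of_real 0) / c)"
    proof (rule has_bochner_integral_FTC_Icc)
      show "((\<lambda>x. exp (c * of_real x) / c) has_vector_derivative expo (k - m) x) (at x within {0..1})" for x
        unfolding ex using c
        by (auto intro!: derivative_eq_intros has_vector_derivative_real_field)
      show "continuous_on {0..1} (\<lambda>x::real. expo (k - m) x)"
        unfolding ex by (intro continuous_intros)
    qed simp
    moreover have "exp c = 1"
    proof -
      obtain n where "k - m = of_int n" using assms by (meson Ints_cases Ints_diff)
      then show ?thesis
        unfolding c_def using exp_integer_2pi[of "of_int n"] by (simp add: mult_ac)
    qed
    ultimately show ?thesis using False by (simp add: has_bochner_integral_integral_eq)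
  qed simp
  finally show ?thesis .
qed

text \<open>Unfolding: a sum over translates averaged over the window I becomes an integral over the
  line, weighted by the number of points of X that bring u into the window.\<close>

lemma nn_integral_translates:
  fixes f :: "real \<Rightarrow> ennreal"
  assumes "countable X" and [measurable]: "f \<in> borel_measurable borel" "I \<in> sets borel"
  shows "(\<integral>\<^sup>+ t. indicator I t * (\<integral>\<^sup>+ m. f (a - m + t) \<partial>count_space X) \<partial>lborel)
    = (\<integral>\<^sup>+ u. f u * (\<integral>\<^sup>+ m. indicator I (u - a + m) \<partial>count_space X) \<partial>lborel)"
proof -
  have "(\<integral>\<^sup>+ t. indicator I t * (\<integral>\<^sup>+ m. f (a - m + t) \<partial>count_space X) \<partial>lborel)
      = (\<integral>\<^sup>+ t. (\<integral>\<^sup>+ m. indicator I t * f (a - m + t) \<partial>count_space X) \<partial>lborel)"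
    by (intro nn_integral_cong nn_integral_cmult[symmetric]) simp
  also have "\<dots> = (\<integral>\<^sup>+ m. (\<integral>\<^sup>+ t. indicator I t * f (a - m + t) \<partial>lborel) \<partial>count_space X)"
    by (rule nn_integral_count_space_nn_integral) (use assms in measurable)
  also have "\<dots> = (\<integral>\<^sup>+ m. (\<integral>\<^sup>+ u. f u * indicator I (u - a + m) \<partial>lborel) \<partial>count_space X)"
  proof (rule nn_integral_cong)
    fix m
    show "(\<integral>\<^sup>+ t. indicator I t * f (a - m + t) \<partial>lborel) = (\<integral>\<^sup>+ u. f u * indicator I (u - a + m) \<partial>lborel)"
      using nn_integral_real_affine[of "\<lambda>u. f u * indicator I (u - a + m)" 1 "a - m"]
      by (simp add: mult.commute)
  qed
  also have "\<dots> = (\<integral>\<^sup>+ u. (\<integral>\<^sup>+ m. f u * indicator I (u - a + m) \<partial>count_space X) \<partial>lborel)"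
    by (rule nn_integral_count_space_nn_integral[symmetric]) (use assms in measurable)
  also have "\<dots> = (\<integral>\<^sup>+ u. f u * (\<integral>\<^sup>+ m. indicator I (u - a + m) \<partial>count_space X) \<partial>lborel)"
    by (intro nn_integral_cong nn_integral_cmult) simp
  finally show ?thesis .
qed

text \<open>The Fourier transform of the indicator function, with the sign for which it is the inner
  product on E of two exponentials whose frequencies differ by \<open>a\<close>.\<close>

definition indicator_ft :: "real set \<Rightarrow> real \<Rightarrow> complex" where
  "indicator_ft E a = (LINT x|lborel. indicator E x *\<^sub>R expo a x)"

section \<open>The Fourier transform of a subset of the unit interval\<close>

locale unit_interval_subset =
  fixes E :: "real set"
  assumes sets_E [measurable]: "E \<in> sets borel" and E_sub: "E \<subseteq> {0..1}"
begin

lemma emeasure_E: "emeasure lborel E = ennreal (measure lborel E)" "measure lborel E \<le> 1"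
proof -
  have "emeasure lborel E \<le> emeasure lborel {0..1::real}"
    by (intro emeasure_mono E_sub) auto
  then have *: "emeasure lborel E \<le> 1" by simp
  then have "emeasure lborel E \<noteq> \<infinity>" by (auto simp: top_unique)
  then show "emeasure lborel E = ennreal (measure lborel E)"
    by (simp add: emeasure_eq_ennreal_measure)
  with * show "measure lborel E \<le> 1" by simp
qed

lemma integrable_indicator_expo: "integrable lborel (\<lambda>x. indicator E x *\<^sub>R expo a x)"
proof (rule Bochner_Integration.integrable_bound)
  show "integrable lborel (indicator E :: real \<Rightarrow> real)"
    using emeasure_E by (intro integrable_real_indicator) auto
qed (auto simp: indicator_def)

lemma L2_inner_expo: "L2_inner E (expo a) (expo b) = indicator_ft E (a - b)"
  unfolding L2_inner_def indicator_ft_def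
  by (subst integral_lebesgue_on_borel) (simp_all add: cnj_expo expo_add[symmetric])

lemma indicator_ft_0: "indicator_ft E 0 = of_real (measure lborel E)"
  unfolding indicator_ft_def by (simp add: scaleR_conv_of_real) 

lemma cnj_indicator_ft: "cnj (indicator_ft E a) = indicator_ft E (- a)"
proof -
  have "cnj (indicator_ft E a) = (LINT x|lborel. cnj (indicator E x *\<^sub>R expo a x))"
    unfolding indicator_ft_def by (rule Bochner_Integration.integral_cnj[symmetric])
  then show ?thesis by (simp add: indicator_ft_def cnj_expo)
qed

lemma indicator_ft_mult_minus: "indicator_ft E a * indicator_ft E (- a) = of_real ((cmod (indicator_ft E a))\<^sup>2)"
  unfolding cnj_indicator_ft[symmetric] complex_norm_square ..

lemma measurable_indicator_ft [measurable]: "indicator_ft E \<in> borel_measurable borel"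
  unfolding indicator_ft_def by measurable

text \<open>For x in [0, 1] the phase 2 pi a x stays within pi / 4 of 0, so the integrand has real
  part at least cos (pi / 4) on E. This is the origin of the separation 1 / 8 of orthogonal
  frequencies.\<close>

lemma indicator_ft_nonzero:
  assumes "0 < measure lborel E" "\<bar>a\<bar> < 1 / 8"
  shows "indicator_ft E a \<noteq> 0"
proof -
  have "Re (indicator_ft E a) = (LINT x|lborel. Re (indicator E x *\<^sub>R expo a x))"
    unfolding indicator_ft_def by (rule integral_Re[symmetric] integrable_indicator_expo)+
  also have "\<dots> \<ge> (LINT x|lborel. indicator E x * cos (pi / 4))"
  proof (rule integral_mono)
    show "integrable lborel (\<lambda>x. indicator E x * cos (pi / 4))"
      using emeasure_E by (intro integrable_mult_left integrable_real_indicator) auto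
    show "integrable lborel (\<lambda>x. Re (indicator E x *\<^sub>R expo a x))"
      using integrable_indicator_expo by (rule integrable_Re)
    show "indicator E x * cos (pi / 4) \<le> Re (indicator E x *\<^sub>R expo a x)" for x
    proof (cases "x \<in> E")
      case True
      then have "0 \<le> x" "x \<le> 1" using E_sub by auto
      then have "\<bar>a * x\<bar> \<le> 1 / 8 * 1" unfolding abs_mult using assms by (intro mult_mono) auto
      then have "2 * pi * \<bar>a * x\<bar> \<le> 2 * pi * (1 / 8)" by (intro mult_left_mono) auto
      then have "\<bar>2 * pi * (a * x)\<bar> \<le> pi / 4" by (simp add: abs_mult)
      then have "cos (pi / 4) \<le> cos \<bar>2 * pi * (a * x)\<bar>"
        by (intro cos_monotone_0_pi_le) auto
      then show ?thesis using True by (simp add: expo_real_cis)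
    qed simp
  qed
  also have "(LINT x|lborel. indicator E x * cos (pi / 4)) = measure lborel E * cos (pi / 4)"
    by simp
  finally show ?thesis using assms(1) cos_gt_zero[of "pi / 4"]
    by (auto simp: mult_le_0_iff)
qed

text \<open>Bessel's inequality on [0, 1] for the indicator of E times \<open>expo a\<close>: as E
  lies in the unit interval, its coefficient at the integer m is
  \<open>indicator_ft E (a - m)\<close>.\<close>

lemma integer_Bessel:
  assumes F: "finite F" "F \<subseteq> \<int>"
  shows "(\<Sum>m\<in>F. (cmod (indicator_ft E (a - m)))\<^sup>2) \<le> 1"
proof -
  let ?M = "restrict_space lborel {0..1::real}"
  let ?\<phi> = "\<lambda>x. indicator E x *\<^sub>R expo a x"
  interpret finite_measure ?M
    by (rule finite_measureI) (simp add: emeasure_restrict_space)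
  have meas: "?\<phi> \<in> borel_measurable ?M" "expo m \<in> borel_measurable ?M" for m
    by (intro measurable_restrict_space1; simp)+
  have coeff: "(LINT x|?M. ?\<phi> x * cnj (expo m x)) = indicator_ft E (a - m)" for m
  proof -
    have "(LINT x|?M. ?\<phi> x * cnj (expo m x)) = (LINT x|lborel. indicator {0..1} x *\<^sub>R (?\<phi> x * cnj (expo m x)))"
      by (subst integral_restrict_space) auto
    also have "\<dots> = indicator_ft E (a - m)"
      unfolding indicator_ft_def using E_sub
      by (intro Bochner_Integration.integral_cong)
         (auto simp: cnj_expo expo_add[symmetric] indicator_def)
    finally show ?thesis .
  qed
  have "(\<Sum>m\<in>F. (cmod (LINT x|?M. ?\<phi> x * cnj (expo m x)))\<^sup>2) \<le> 1 * (LINT x|?M. (cmod (?\<phi> x))\<^sup>2)"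
    using F by (intro Bessel_inequality meas) (auto simp: subset_iff expo_orthonormal_unit_interval indicator_def)
  also have "(LINT x|?M. (cmod (?\<phi> x))\<^sup>2) \<le> (LINT x|?M. 1)"
  proof (intro integral_mono integrable_const_bound[of _ 1])
    show "(\<lambda>x. (cmod (?\<phi> x))\<^sup>2) \<in> borel_measurable ?M"
      using meas(1) by measurable
  qed (auto simp: indicator_def)
  also have "\<dots> = 1" by (simp add: measure_restrict_space)
  finally show ?thesis unfolding coeff by simp
qed

text \<open>One half of Plancherel, with the bound 1 in place of |E|. Periodization turns the
  integral over the line into an integral over t in [0, 1) of sums over the integers, each at most 1
  by Bessel.\<close>

lemma nn_integral_indicator_ft_square_le: "(\<integral>\<^sup>+ u. ennreal ((cmod (indicator_ft E u))\<^sup>2) \<partial>lborel) \<le> 1"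
proof -
  let ?f = "\<lambda>u. ennreal ((cmod (indicator_ft E u))\<^sup>2)"
  have countable_Ints: "countable (\<int> :: real set)"
    unfolding Ints_def by simp
  have "(\<integral>\<^sup>+ u. ?f u \<partial>lborel)
      \<le> (\<integral>\<^sup>+ u. ?f u * (\<integral>\<^sup>+ m. indicator {0..<1} (u - 0 + m) \<partial>count_space \<int>) \<partial>lborel)"
  proof (rule nn_integral_mono)
    fix u :: real
    \<comment> \<open>This integer moves u into [0, 1), so the weight inserted here is at least
      1.\<close>
    have "of_int (- \<lfloor>u\<rfloor>) \<in> (\<int> :: real set)" by simp
    then have "indicator {0..<1} (u - 0 + of_int (- \<lfloor>u\<rfloor>))
        \<le> (\<integral>\<^sup>+ m. indicator {0..<1} (u - 0 + m) \<partial>count_space \<int>)"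
      by (rule nn_integral_ge_point)
    moreover have "u - 0 + of_int (- \<lfloor>u\<rfloor>) \<in> {0..<1}" by simp linarith
    ultimately have "1 \<le> (\<integral>\<^sup>+ m. indicator {0..<1} (u - 0 + m) \<partial>count_space \<int>)"
      by (metis indicator_simps(1))
    then show "?f u \<le> ?f u * (\<integral>\<^sup>+ m. indicator {0..<1} (u - 0 + m) \<partial>count_space \<int>)"
      using mult_left_mono[of 1 _ "?f u"] by simp
  qed
  also have "\<dots> = (\<integral>\<^sup>+ t. indicator {0..<1} t * (\<integral>\<^sup>+ m. ?f (0 - m + t) \<partial>count_space \<int>) \<partial>lborel)"
    by (rule nn_integral_translates[symmetric]) (auto simp: countable_Ints)
  also have "\<dots> \<le> (\<integral>\<^sup>+ t. indicator {0..<1::real} t * 1 \<partial>lborel)"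
  proof (rule nn_integral_mono, rule mult_left_mono, rule nn_integral_count_space_le)
    fix t :: real and F assume F: "finite F" "F \<subseteq> (\<int> :: real set)"
    have "(\<Sum>m\<in>F. ?f (0 - m + t)) = ennreal (\<Sum>m\<in>F. (cmod (indicator_ft E (t - m)))\<^sup>2)"
      by (simp add: sum_ennreal)
    also have "\<dots> \<le> 1" using integer_Bessel[OF F] by (simp add: ennreal_le_1)
    finally show "(\<Sum>m\<in>F. ?f (0 - m + t)) \<le> 1" .
  qed (auto simp: countable_Ints)
  also have "\<dots> = 1" by simp
  finally show ?thesis .
qed

lemma integrable_indicator_ft_square: "integrable lborel (\<lambda>u. (cmod (indicator_ft E u))\<^sup>2)"
  using nn_integral_indicator_ft_square_le
  by (intro integrableI_bounded) (auto simp: less_top[symmetric] top_unique)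

lemma nn_integral_indicator_ft_square_tail:
  assumes "0 < \<epsilon>"
  obtains R where "0 \<le> R" "(\<integral>\<^sup>+ u. ennreal ((cmod (indicator_ft E u))\<^sup>2) * indicator {u. R < \<bar>u\<bar>} u \<partial>lborel) \<le> ennreal \<epsilon>"
proof -
  let ?f = "\<lambda>u. (cmod (indicator_ft E u))\<^sup>2"
  have "(\<lambda>n. LINT u|lborel. ?f u * indicator {u. real n < \<bar>u\<bar>} u) \<longlonglongrightarrow> (LINT u::real|lborel. (0::real))"
  proof (rule integral_dominated_convergence[where w = ?f])
    show "AE u in lborel. (\<lambda>n. ?f u * indicator {u. real n < \<bar>u\<bar>} u) \<longlonglongrightarrow> 0"
    proof (rule AE_I2)
      fix u :: real
      have "\<forall>\<^sub>F n in sequentially. \<bar>u\<bar> \<le> real n"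
        using real_arch_simple[of "\<bar>u\<bar>"] by (meson eventually_sequentiallyI of_nat_le_iff order_trans)
      then have "\<forall>\<^sub>F n in sequentially. ?f u * indicator {u. real n < \<bar>u\<bar>} u = 0"
        by eventually_elim auto
      then show "(\<lambda>n. ?f u * indicator {u. real n < \<bar>u\<bar>} u) \<longlonglongrightarrow> 0"
        by (rule tendsto_eventually)
    qed
    show "integrable lborel ?f" by (rule integrable_indicator_ft_square)
  qed (auto simp: indicator_def)
  then have "\<forall>\<^sub>F n in sequentially. (LINT u|lborel. ?f u * indicator {u. real n < \<bar>u\<bar>} u) < \<epsilon>"
    using assms by (intro order_tendstoD) auto
  then obtain n where n: "(LINT u|lborel. ?f u * indicator {u. real n < \<bar>u\<bar>} u) < \<epsilon>"
    by (auto simp: eventually_sequentially)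
  have "(\<integral>\<^sup>+ u. ennreal (?f u) * indicator {u. real n < \<bar>u\<bar>} u \<partial>lborel)
      = (\<integral>\<^sup>+ u. ennreal (?f u * indicator {u. real n < \<bar>u\<bar>} u) \<partial>lborel)"
    by (intro nn_integral_cong) (auto simp: indicator_def)
  also have "\<dots> = ennreal (LINT u|lborel. ?f u * indicator {u. real n < \<bar>u\<bar>} u)"
    by (intro nn_integral_eq_integral integrable_mult_indicator[of _ _ ?f, simplified mult.commute] integrable_real_mult_indicator integrable_indicator_ft_square) auto
  also have "\<dots> \<le> ennreal \<epsilon>" using n by (intro ennreal_leI) simp
  finally show thesis by (intro that[of "real n"]) auto
qed

text \<open>The window is half-open and its length 1 / 8 equals the separation of X, so it contains
  at most one of the points u - a + m. Hence the unfolded weight is at most 1, and it vanishes off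
  S.\<close>

lemma nn_integral_separated_translates_le:
  assumes "countable X" and sep: "\<And>l m. l \<in> X \<Longrightarrow> m \<in> X \<Longrightarrow> l \<noteq> m \<Longrightarrow> 1 / 8 \<le> \<bar>l - m\<bar>"
    and S: "\<And>m t. m \<in> X \<Longrightarrow> t \<in> {1 / 4..<3 / 8} \<Longrightarrow> a - m + t \<in> S"
  shows "(\<integral>\<^sup>+ t. indicator {1 / 4..<3 / 8} t * (\<integral>\<^sup>+ m. ennreal ((cmod (indicator_ft E (a - m + t)))\<^sup>2) \<partial>count_space X) \<partial>lborel)
    \<le> (\<integral>\<^sup>+ u. ennreal ((cmod (indicator_ft E u))\<^sup>2) * indicator S u \<partial>lborel)"
proof -
  let ?I = "{1 / 4..<3 / 8 :: real}"
  have "(\<integral>\<^sup>+ m. indicator ?I (u - a + m) \<partial>count_space X) \<le> (indicator S u :: ennreal)" for u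
  proof (rule nn_integral_count_space_le)
    fix F assume F: "finite F" "F \<subseteq> X"
    let ?Y = "{m \<in> F. u - a + m \<in> ?I}"
    have card: "card ?Y \<le> (if u \<in> S then 1 else 0)"
    proof (cases "u \<in> S")
      case True
      have "l = m" if "l \<in> ?Y" "m \<in> ?Y" for l m
      proof (rule ccontr)
        assume "l \<noteq> m"
        then have "1 / 8 \<le> \<bar>l - m\<bar>" using that F sep by blast
        moreover have "1 / 4 \<le> u - a + l" "u - a + l < 3 / 8" "1 / 4 \<le> u - a + m" "u - a + m < 3 / 8"
          using that by auto
        ultimately show False by linarith
      qed
      then show ?thesis using F True by (simp add: card_le_Suc0_iff_eq)
    next
      case False
      have empty: "?Y = {}"
      proof (rule ccontr)
        assume "?Y \<noteq> {}"
        then obtain m where "m \<in> X" "u - a + m \<in> ?I" using F by auto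
        then show False using S[of m "u - a + m"] False by simp
      qed
      show ?thesis unfolding empty by simp
    qed
    have "(\<Sum>m\<in>F. indicator ?I (u - a + m)) = (of_nat (card ?Y) :: ennreal)"
      using F by (simp add: indicator_def sum.If_cases Int_def)
    also have "\<dots> \<le> of_nat (if u \<in> S then 1 else 0)"
      by (rule of_nat_mono[OF card])
    also have "\<dots> = indicator S u" by simp
    finally show "(\<Sum>m\<in>F. indicator ?I (u - a + m)) \<le> (indicator S u :: ennreal)" .
  qed fact
  then show ?thesis
    using assms(1) by (subst nn_integral_translates) (auto intro!: nn_integral_mono mult_left_mono)
qed

text \<open>Linearity reduces both integrals to values of \<open>indicator_ft\<close>; nonnegativity
  of \<open>P\<close> lets the Bochner integrals be read as nonnegative integrals. In the double
  integral the values at a and - a combine to a squared modulus.\<close>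

lemma
  fixes w :: "'i \<Rightarrow> complex" and a :: "'i \<Rightarrow> real"
  assumes K: "finite K"
    and P: "\<And>u. P u = Re (\<Sum>i\<in>K. w i * expo (a i) u)" "\<And>u. 0 \<le> P u"
  shows nn_integral_convolution_trig_polynomial:
      "(\<integral>\<^sup>+ y. indicator E (x - y) * ennreal (P y) \<partial>lborel)
        = ennreal (Re (\<Sum>i\<in>K. w i * expo (a i) x * indicator_ft E (- a i)))"
    and nn_integral_double_trig_polynomial:
      "(\<integral>\<^sup>+ x. indicator E x * (\<integral>\<^sup>+ y. indicator E (x - y) * ennreal (P y) \<partial>lborel) \<partial>lborel)
        = ennreal (Re (\<Sum>i\<in>K. w i * of_real ((cmod (indicator_ft E (a i)))\<^sup>2)))"
proof -
  have [measurable]: "P \<in> borel_measurable borel" unfolding P(1) by measurable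
  have hb: "has_bochner_integral lborel (\<lambda>x. indicator E x *\<^sub>R expo b x) (indicator_ft E b)" for b
    unfolding indicator_ft_def by (rule has_bochner_integral_integrable integrable_indicator_expo)+
  define R where "R x = Re (\<Sum>i\<in>K. w i * expo (a i) x * indicator_ft E (- a i))" for x
  have inner: "has_bochner_integral lborel (\<lambda>z. indicator E z * P (x - z)) (R x)" for x
  proof -
    have "has_bochner_integral lborel
        (\<lambda>z. Re (\<Sum>i\<in>K. w i * expo (a i) x * (indicator E z *\<^sub>R expo (- a i) z))) (R x)"
      unfolding R_def
      by (intro has_bochner_integral_Re has_bochner_integral_sum has_bochner_integral_mult_right hb)
    moreover have "Re (\<Sum>i\<in>K. w i * expo (a i) x * (indicator E z *\<^sub>R expo (- a i) z)) = indicator E z * P (x - z)" for z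
      unfolding P(1) expo_diff_right by (simp add: indicator_def mult.assoc)
    ultimately show ?thesis by simp
  qed
  have R_nonneg: "0 \<le> R x" for x
    using P(2) by (subst has_bochner_integral_integral_eq[OF inner, symmetric])
      (simp add: integral_nonneg_AE)
  show conv: "(\<integral>\<^sup>+ y. indicator E (x - y) * ennreal (P y) \<partial>lborel) = ennreal (Re (\<Sum>i\<in>K. w i * expo (a i) x * indicator_ft E (- a i)))" for x
  proof -
    have "(\<integral>\<^sup>+ y. indicator E (x - y) * ennreal (P y) \<partial>lborel) = (\<integral>\<^sup>+ z. indicator E z * ennreal (P (x - z)) \<partial>lborel)"
      using nn_integral_real_affine[of "\<lambda>y. indicator E (x - y) * ennreal (P y)" "-1" x] by simp
    also have "\<dots> = (\<integral>\<^sup>+ z. ennreal (indicator E z * P (x - z)) \<partial>lborel)"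
      by (intro nn_integral_cong) (simp add: indicator_def)
    also have "\<dots> = ennreal (R x)"
      using P(2) by (intro nn_integral_eq_integral[THEN trans])
        (use inner[of x] in \<open>auto simp: has_bochner_integral_iff\<close>)
    finally show ?thesis by (simp add: R_def)
  qed
  have "has_bochner_integral lborel
      (\<lambda>x. Re (\<Sum>i\<in>K. (w i * indicator_ft E (- a i)) * (indicator E x *\<^sub>R expo (a i) x)))
      (Re (\<Sum>i\<in>K. (w i * indicator_ft E (- a i)) * indicator_ft E (a i)))"
    by (intro has_bochner_integral_Re has_bochner_integral_sum has_bochner_integral_mult_right hb)
  moreover have "Re (\<Sum>i\<in>K. (w i * indicator_ft E (- a i)) * (indicator E x *\<^sub>R expo (a i) x)) = indicator E x * R x" for x
    unfolding R_def by (simp add: indicator_def mult_ac)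
  moreover have "(w i * indicator_ft E (- a i)) * indicator_ft E (a i) = w i * of_real ((cmod (indicator_ft E (a i)))\<^sup>2)" for i
    using indicator_ft_mult_minus[of "a i"] by (simp add: mult_ac)
  ultimately have outer: "has_bochner_integral lborel (\<lambda>x. indicator E x * R x)
      (Re (\<Sum>i\<in>K. w i * of_real ((cmod (indicator_ft E (a i)))\<^sup>2)))" by simp
  have "(\<integral>\<^sup>+ x. indicator E x * (\<integral>\<^sup>+ y. indicator E (x - y) * ennreal (P y) \<partial>lborel) \<partial>lborel)
     = (\<integral>\<^sup>+ x. ennreal (indicator E x * R x) \<partial>lborel)"
    unfolding conv R_def by (intro nn_integral_cong) (simp add: indicator_def)
  also have "\<dots> = ennreal (Re (\<Sum>i\<in>K. w i * of_real ((cmod (indicator_ft E (a i)))\<^sup>2)))"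
    using R_nonneg by (intro nn_integral_eq_integral[THEN trans])
      (use outer in \<open>auto simp: has_bochner_integral_iff\<close>)
  finally show "(\<integral>\<^sup>+ x. indicator E x * (\<integral>\<^sup>+ y. indicator E (x - y) * ennreal (P y) \<partial>lborel) \<partial>lborel)
     = ennreal (Re (\<Sum>i\<in>K. w i * of_real ((cmod (indicator_ft E (a i)))\<^sup>2)))" .
qed

end

section \<open>Countable sums and separated sets\<close>

lemma borel_measurable_nn_integral_count_space:
  fixes f :: "'i \<Rightarrow> 'a \<Rightarrow> ennreal"
  assumes "countable X" and [measurable]: "\<And>i. i \<in> X \<Longrightarrow> f i \<in> borel_measurable M"
  shows "(\<lambda>x. \<integral>\<^sup>+ i. f i x \<partial>count_space X) \<in> borel_measurable M"
proof (cases "finite X")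
  case True
  then show ?thesis by (simp add: nn_integral_count_space_finite)
next
  case False
  have bij: "bij_betw (from_nat_into X) UNIV X"
    using assms(1) False by (rule bij_betw_from_nat_into)
  have "(\<integral>\<^sup>+ i. f i x \<partial>count_space X) = (\<Sum>n. f (from_nat_into X n) x)" for x
    by (subst nn_integral_bij_count_space[OF bij, symmetric]) (rule nn_integral_count_space_nat)
  moreover have "f (from_nat_into X n) \<in> borel_measurable M" for n
    using False by (intro assms(2) from_nat_into) auto
  ultimately show ?thesis by simp
qed

lemma sum_le_nn_integral_count_space:
  fixes f :: "'a \<Rightarrow> ennreal"
  assumes "finite A" "A \<subseteq> X"
  shows "sum f A \<le> (\<integral>\<^sup>+ x. f x \<partial>count_space X)"
proof -
  have "sum f A = (\<Sum>x\<in>A. f x * indicator A x)" by (intro sum.cong) auto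
  also have "\<dots> = (\<integral>\<^sup>+ x. f x * indicator A x \<partial>count_space X)"
    using assms by (intro nn_integral_count_space'[symmetric]) auto
  also have "\<dots> \<le> (\<integral>\<^sup>+ x. f x \<partial>count_space X)"
    by (intro nn_integral_mono) (auto simp: indicator_def)
  finally show ?thesis .
qed

text \<open>Points at distance at least d have different floors of x / d, so it suffices to count
  integers between two floors.\<close>

lemma card_separated_le:
  fixes X :: "real set"
  assumes "0 < d" and sep: "\<And>x y. x \<in> X \<Longrightarrow> y \<in> X \<Longrightarrow> x \<noteq> y \<Longrightarrow> d \<le> \<bar>x - y\<bar>"
    and X: "X \<subseteq> {a..b}" and "a \<le> b"
  shows "finite X" "real (card X) \<le> (b - a) / d + 2"
proof -
  let ?g = "\<lambda>x. \<lfloor>x / d\<rfloor>"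
  have inj: "inj_on ?g X"
  proof (rule inj_onI, rule ccontr)
    fix x y assume xy: "x \<in> X" "y \<in> X" "?g x = ?g y" "x \<noteq> y"
    have "1 = d / d" using \<open>0 < d\<close> by simp
    also have "\<dots> \<le> \<bar>x - y\<bar> / d" using sep[OF xy(1,2,4)] \<open>0 < d\<close> by (intro divide_right_mono) auto
    also have "\<dots> = \<bar>x / d - y / d\<bar>" using \<open>0 < d\<close> by (simp add: diff_divide_distrib[symmetric] abs_divide)
    finally show False using xy(3) by linarith
  qed
  have sub: "?g ` X \<subseteq> {\<lfloor>a / d\<rfloor>..\<lfloor>b / d\<rfloor>}"
    using X \<open>0 < d\<close> by (force intro!: floor_mono divide_right_mono)
  then show "finite X"
    using inj by (metis finite_atLeastAtMost_int finite_imageD finite_subset)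
  have "card X = card (?g ` X)" using inj by (simp add: card_image)
  also have "\<dots> \<le> card {\<lfloor>a / d\<rfloor>..\<lfloor>b / d\<rfloor>}" using sub by (intro card_mono) auto
  also have "\<dots> = nat (\<lfloor>b / d\<rfloor> - \<lfloor>a / d\<rfloor> + 1)" by simp
  finally have "real (card X) \<le> real (nat (\<lfloor>b / d\<rfloor> - \<lfloor>a / d\<rfloor> + 1))" by simp
  also have "\<dots> \<le> b / d - a / d + 2"
  proof -
    have "\<lfloor>a / d\<rfloor> \<le> \<lfloor>b / d\<rfloor>" using \<open>a \<le> b\<close> \<open>0 < d\<close> by (intro floor_mono divide_right_mono) auto
    then show ?thesis by linarith
  qed
  finally show "real (card X) \<le> (b - a) / d + 2" by (simp add: diff_divide_distrib)
qed

lemma sum_diagonal: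
  fixes c :: real
  assumes "finite F"
  shows "(\<Sum>p\<in>F \<times> F. if fst p = snd p then c else 0) = real (card F) * c"
proof -
  have "(\<Sum>p\<in>F \<times> F. if fst p = snd p then c else 0) = (\<Sum>l\<in>F. \<Sum>m\<in>F. if l = m then c else 0)"
    by (simp add: sum.cartesian_product case_prod_unfold)
  also have "\<dots> = real (card F) * c" using assms by simp
  finally show ?thesis .
qed

section \<open>Squared sums of orthogonal exponentials\<close>

locale orthogonal_exponentials = unit_interval_subset +
  fixes \<Lambda> :: "real set"
  assumes pos: "0 < measure lborel E"
    and countable: "countable \<Lambda>"
    and orth: "\<And>l m. l \<in> \<Lambda> \<Longrightarrow> m \<in> \<Lambda> \<Longrightarrow> l \<noteq> m \<Longrightarrow> indicator_ft E (l - m) = 0"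
begin

abbreviation "V \<equiv> measure lborel E"

abbreviation power_spectrum :: "real \<Rightarrow> real" where
  "power_spectrum u \<equiv> (cmod (indicator_ft E u))\<^sup>2"

lemma separated: "1 / 8 \<le> \<bar>l - m\<bar>" if "l \<in> \<Lambda>" "m \<in> \<Lambda>" "l \<noteq> m"
  using orth[OF that] indicator_ft_nonzero[OF pos, of "l - m"] by force

lemma
  assumes "a \<le> b"
  shows finite_Int_interval: "finite (\<Lambda> \<inter> {a..b})"
    and card_Int_interval: "real (card (\<Lambda> \<inter> {a..b})) \<le> 8 * (b - a) + 2"
proof -
  have *: "1 / 8 \<le> \<bar>l - m\<bar>" if "l \<in> \<Lambda> \<inter> {a..b}" "m \<in> \<Lambda> \<inter> {a..b}" "l \<noteq> m" for l m
    using that by (intro separated) auto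
  note card_separated_le[where d = "1 / 8" and X = "\<Lambda> \<inter> {a..b}", OF _ * Int_lower2 assms]
  then show "finite (\<Lambda> \<inter> {a..b})" "real (card (\<Lambda> \<inter> {a..b})) \<le> 8 * (b - a) + 2"
    by simp_all
qed

definition trig_sum :: "real set \<Rightarrow> real \<Rightarrow> complex" where
  "trig_sum F u = (\<Sum>l\<in>F. expo l u)"

lemma measurable_trig_sum [measurable]: "trig_sum F \<in> borel_measurable borel"
  unfolding trig_sum_def by measurable

lemma trig_sum_square:
  "of_real ((cmod (trig_sum F u))\<^sup>2) = (\<Sum>p\<in>F \<times> F. expo (fst p - snd p) u)"
proof -
  have "of_real ((cmod (trig_sum F u))\<^sup>2) = (\<Sum>l\<in>F. \<Sum>m\<in>F. expo l u * cnj (expo m u))"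
    unfolding complex_norm_square trig_sum_def by (simp add: sum_product)
  also have "\<dots> = (\<Sum>p\<in>F \<times> F. expo (fst p - snd p) u)"
    by (simp add: sum.cartesian_product case_prod_unfold cnj_expo expo_add[symmetric])
  finally show ?thesis .
qed

lemma convolution_trig_sum:
  assumes F: "finite F" "F \<subseteq> \<Lambda>"
  shows "(\<integral>\<^sup>+ y. indicator E (x - y) * ennreal ((cmod (trig_sum F y))\<^sup>2) \<partial>lborel) = ennreal (card F * V)"
proof -
  have "(cmod (trig_sum F u))\<^sup>2 = Re (\<Sum>p\<in>F \<times> F. 1 * expo (fst p - snd p) u)" for u
    by (simp only: mult_1 trig_sum_square[symmetric] Re_complex_of_real)
  then have "(\<integral>\<^sup>+ y. indicator E (x - y) * ennreal ((cmod (trig_sum F y))\<^sup>2) \<partial>lborel)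
      = ennreal (Re (\<Sum>p\<in>F \<times> F. 1 * expo (fst p - snd p) x * indicator_ft E (- (fst p - snd p))))"
    using F(1) by (intro nn_integral_convolution_trig_polynomial) (blast, blast, rule zero_le_power2)
  also have "(\<Sum>p\<in>F \<times> F. 1 * expo (fst p - snd p) x * indicator_ft E (- (fst p - snd p)))
      = (\<Sum>p\<in>F \<times> F. of_real (if fst p = snd p then V else 0))"
  proof (rule sum.cong)
    fix p assume "p \<in> F \<times> F"
    then have "snd p \<in> \<Lambda>" "fst p \<in> \<Lambda>" using F by auto
    then show "1 * expo (fst p - snd p) x * indicator_ft E (- (fst p - snd p)) = of_real (if fst p = snd p then V else 0)"
      using orth[of "snd p" "fst p"] indicator_ft_0 by auto
  qed simp
  also have "Re \<dots> = real (card F) * V"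
    by (simp only: of_real_sum[symmetric] sum_diagonal[OF F(1)] Re_complex_of_real)
  finally show ?thesis .
qed

text \<open>The factor 1 - cos (2 pi t y) is the real part of 1 - \<open>expo t y\<close>, and
  multiplication by \<open>expo t\<close> moves each frequency difference l - m to l - m + t. By
  orthogonality the unshifted terms leave only the diagonal, which contributes
  \<open>V\<^sup>2\<close> to each row.\<close>

lemma double_trig_sum:
  assumes F: "finite F" "F \<subseteq> \<Lambda>"
  shows "(\<integral>\<^sup>+ x. indicator E x * (\<integral>\<^sup>+ y. indicator E (x - y) *
        ennreal ((cmod (trig_sum F y))\<^sup>2 * (1 - cos (2 * pi * (t * y)))) \<partial>lborel) \<partial>lborel)
      = ennreal (\<Sum>l\<in>F. V\<^sup>2 - (\<Sum>m\<in>F. power_spectrum (l - m + t)))"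
proof -
  \<comment> \<open>The Boolean tag joins two families of frequencies in one sum: l - m with weight
    1 for True, l - m + t with weight - 1 for False.\<close>
  define w :: "(real \<times> real) \<times> bool \<Rightarrow> complex" where "w q = (if snd q then 1 else - 1)" for q
  define a :: "(real \<times> real) \<times> bool \<Rightarrow> real" where
    "a q = fst (fst q) - snd (fst q) + (if snd q then 0 else t)" for q
  let ?K = "(F \<times> F) \<times> (UNIV :: bool set)"
  have split: "(\<Sum>q\<in>?K. w q * h (a q)) = (\<Sum>p\<in>F \<times> F. h (fst p - snd p) - h (fst p - snd p + t))"
    for h :: "real \<Rightarrow> complex"
  proof -
    have "(\<Sum>q\<in>?K. w q * h (a q)) = (\<Sum>p\<in>F \<times> F. \<Sum>b\<in>UNIV. w (p, b) * h (a (p, b)))"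
      unfolding sum.cartesian_product by (simp only: case_prod_eta case_prod_unfold prod.collapse)
    then show ?thesis by (simp add: UNIV_bool w_def a_def add.commute)
  qed
  have nonneg: "0 \<le> (cmod (trig_sum F u))\<^sup>2 * (1 - cos (2 * pi * (t * u)))" for u
    by simp
  have P: "(cmod (trig_sum F u))\<^sup>2 * (1 - cos (2 * pi * (t * u))) = Re (\<Sum>q\<in>?K. w q * expo (a q) u)" for u
  proof -
    have "(\<Sum>q\<in>?K. w q * expo (a q) u) = (\<Sum>p\<in>F \<times> F. expo (fst p - snd p) u * (1 - expo t u))"
      unfolding split[of "\<lambda>v. expo v u"] by (simp only: expo_add right_diff_distrib mult_1_right)
    also have "\<dots> = of_real ((cmod (trig_sum F u))\<^sup>2) * (1 - expo t u)"
      by (simp only: sum_distrib_right[symmetric] trig_sum_square)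
    finally show ?thesis by (simp add: expo_real_cis)
  qed
  have "(\<integral>\<^sup>+ x. indicator E x * (\<integral>\<^sup>+ y. indicator E (x - y) *
        ennreal ((cmod (trig_sum F y))\<^sup>2 * (1 - cos (2 * pi * (t * y)))) \<partial>lborel) \<partial>lborel)
      = ennreal (Re (\<Sum>q\<in>?K. w q * of_real (power_spectrum (a q))))"
    using F(1) P by (intro nn_integral_double_trig_polynomial) (simp, blast, rule nonneg)
  also have "(\<Sum>q\<in>?K. w q * of_real (power_spectrum (a q)))
      = of_real (\<Sum>p\<in>F \<times> F. power_spectrum (fst p - snd p) - power_spectrum (fst p - snd p + t))"
    unfolding split[of "\<lambda>u. of_real (power_spectrum u)"] by simp
  also have "(\<Sum>p\<in>F \<times> F. power_spectrum (fst p - snd p) - power_spectrum (fst p - snd p + t))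
      = (\<Sum>p\<in>F \<times> F. (if fst p = snd p then V\<^sup>2 else 0)) - (\<Sum>p\<in>F \<times> F. power_spectrum (fst p - snd p + t))"
    unfolding sum_subtractf
  proof (intro arg_cong2[of _ _ _ _ "(-)"] sum.cong refl)
    fix p assume "p \<in> F \<times> F"
    then have "snd p \<in> \<Lambda>" "fst p \<in> \<Lambda>" using F by auto
    then show "power_spectrum (fst p - snd p) = (if fst p = snd p then V\<^sup>2 else 0)"
      using orth[of "fst p" "snd p"] indicator_ft_0 by auto
  qed
  also have "\<dots> = (\<Sum>l\<in>F. V\<^sup>2 - (\<Sum>m\<in>F. power_spectrum (l - m + t)))"
    unfolding sum_diagonal[OF F(1)] sum_subtractf
    by (simp add: sum.cartesian_product case_prod_unfold)
  finally show ?thesis by (simp only: Re_complex_of_real)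
qed

end

section \<open>Spectra: Parseval's relation and the mass that leaves F\<close>

locale spectrum = orthogonal_exponentials +
  assumes complete: "\<And>f \<epsilon>. square_integrable_on f E \<Longrightarrow> 0 < \<epsilon> \<Longrightarrow>
    \<exists>F c. finite F \<and> F \<subseteq> \<Lambda> \<and> L2_norm_on E (\<lambda>x. f x - (\<Sum>l\<in>F. c l * expo l x)) < \<epsilon>"
begin

text \<open>Completeness is applied to \<open>expo a\<close> itself, whose Fourier coefficients are
  \<open>indicator_ft E (a - m)\<close>. Multiplying the defect by V \<le> 1 keeps the error below
  \<open>\<epsilon>\<close>.\<close>

lemma Parseval_approximation:
  assumes "0 < \<epsilon>"
  obtains F where "finite F" "F \<subseteq> \<Lambda>" "V\<^sup>2 \<le> (\<Sum>m\<in>F. power_spectrum (a - m)) + \<epsilon>"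
proof -
  let ?M = "lebesgue_on E"
  have E: "E \<in> sets lebesgue" by simp
  have space: "measure ?M E = V"
    using E by (simp add: measure_restrict_space)
  have em: "emeasure ?M (space ?M) = emeasure lborel E"
    using E by (simp add: emeasure_restrict_space)
  interpret M: finite_measure ?M
    by (rule finite_measureI) (simp only: em emeasure_E(1), simp)
  have meas: "expo m \<in> borel_measurable ?M" for m
    by (rule lebesgue_on_measurable_borel) simp
  have "square_integrable_on (expo a) E"
    unfolding square_integrable_on_def using meas by simp
  from complete[OF this, of "sqrt \<epsilon>"] obtain F c where F: "finite F" "F \<subseteq> \<Lambda>"
    and less: "L2_norm_on E (\<lambda>x. expo a x - (\<Sum>l\<in>F. c l * expo l x)) < sqrt \<epsilon>"
    using assms by auto
  have inner: "(LINT x|?M. expo l x * cnj (expo m x)) = indicator_ft E (l - m)" for l m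
    using L2_inner_expo by (simp add: L2_inner_def)
  have orth': "(LINT x|?M. expo l x * cnj (expo m x)) = (if l = m then of_real V else 0)"
    if "l \<in> F" "m \<in> F" for l m
    unfolding inner using that F orth[of l m] indicator_ft_0 by auto
  have "(LINT x|?M. (cmod (expo a x))\<^sup>2) - (\<Sum>m\<in>F. (cmod (LINT x|?M. expo a x * cnj (expo m x)))\<^sup>2) / V
      \<le> (LINT x|?M. (cmod (expo a x - (\<Sum>m\<in>F. c m * expo m x)))\<^sup>2)"
    by (rule M.Bessel_approximation[OF meas meas _ _ F(1) pos orth']) auto
  also have "\<dots> < \<epsilon>"
    using less by (simp add: L2_norm_on_def real_sqrt_less_iff)
  finally have "V - (\<Sum>m\<in>F. power_spectrum (a - m)) / V < \<epsilon>"
    by (simp add: inner space)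
  then have "V * (V - (\<Sum>m\<in>F. power_spectrum (a - m)) / V) \<le> V * \<epsilon>"
    using pos by (intro mult_left_mono) auto
  also have "V * \<epsilon> \<le> 1 * \<epsilon>"
    using assms emeasure_E(2) by (intro mult_right_mono) auto
  finally have "V\<^sup>2 \<le> (\<Sum>m\<in>F. power_spectrum (a - m)) + \<epsilon>"
    using pos by (simp add: algebra_simps power2_eq_square)
  with F show thesis by (rule that)
qed

text \<open>The lower bound given by completeness, split along F. With a = l + t it says that
  whatever row l lacks inside F is carried by the columns outside F.\<close>

lemma Parseval_le:
  assumes F: "finite F" "F \<subseteq> \<Lambda>"
  shows "ennreal (V\<^sup>2) \<le> ennreal (\<Sum>m\<in>F. power_spectrum (a - m))
    + (\<integral>\<^sup>+ m. ennreal (power_spectrum (a - m)) \<partial>count_space (\<Lambda> - F))"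
proof (rule ennreal_le_epsilon)
  fix \<epsilon> :: real assume "0 < \<epsilon>"
  then obtain F' where F': "finite F'" "F' \<subseteq> \<Lambda>" "V\<^sup>2 \<le> (\<Sum>m\<in>F'. power_spectrum (a - m)) + \<epsilon>"
    using Parseval_approximation by blast
  have "(\<Sum>m\<in>F'. power_spectrum (a - m)) \<le> (\<Sum>m\<in>F \<union> (F' - F). power_spectrum (a - m))"
    using F F' by (intro sum_mono2) auto
  also have "\<dots> = (\<Sum>m\<in>F. power_spectrum (a - m)) + (\<Sum>m\<in>F' - F. power_spectrum (a - m))"
    using F F' by (intro sum.union_disjoint) auto
  finally have "ennreal (V\<^sup>2) \<le> ennreal ((\<Sum>m\<in>F. power_spectrum (a - m)) + (\<Sum>m\<in>F' - F. power_spectrum (a - m)) + \<epsilon>)"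
    using F' by (intro ennreal_leI) simp
  also have "\<dots> = ennreal (\<Sum>m\<in>F. power_spectrum (a - m)) + (\<Sum>m\<in>F' - F. ennreal (power_spectrum (a - m))) + ennreal \<epsilon>"
    using \<open>0 < \<epsilon>\<close> by (simp add: ennreal_plus sum_nonneg sum_ennreal)
  also have "\<dots> \<le> ennreal (\<Sum>m\<in>F. power_spectrum (a - m))
    + (\<integral>\<^sup>+ m. ennreal (power_spectrum (a - m)) \<partial>count_space (\<Lambda> - F)) + ennreal \<epsilon>"
    using F' by (intro add_mono sum_le_nn_integral_count_space order_refl) auto
  finally show "ennreal (V\<^sup>2) \<le> ennreal (\<Sum>m\<in>F. power_spectrum (a - m))
    + (\<integral>\<^sup>+ m. ennreal (power_spectrum (a - m)) \<partial>count_space (\<Lambda> - F)) + ennreal \<epsilon>" .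
qed

text \<open>A finite \<open>\<Lambda>\<close> would bound a positive constant on the whole line by
  finitely many translates of an integrable function.\<close>

lemma infinite_spectrum: "infinite \<Lambda>"
proof
  assume fin: "finite \<Lambda>"
  have "(\<integral>\<^sup>+ a. ennreal (V\<^sup>2) \<partial>(lborel :: real measure)) \<le> (\<integral>\<^sup>+ a. (\<Sum>m\<in>\<Lambda>. ennreal (power_spectrum (a - m))) \<partial>lborel)"
    using Parseval_le[OF fin] by (intro nn_integral_mono) (simp add: sum_ennreal nn_integral_empty)
  also have "\<dots> = (\<Sum>m\<in>\<Lambda>. \<integral>\<^sup>+ a. ennreal (power_spectrum (a - m)) \<partial>lborel)"
    by (rule nn_integral_sum) measurable
  also have "\<dots> \<le> (\<Sum>m\<in>\<Lambda>. 1)"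
  proof (rule sum_mono)
    fix m
    have "(\<integral>\<^sup>+ a. ennreal (power_spectrum (a - m)) \<partial>lborel) = (\<integral>\<^sup>+ u. ennreal (power_spectrum u) \<partial>lborel)"
      using nn_integral_real_affine[of "\<lambda>u. ennreal (power_spectrum u)" 1 "- m"] by simp
    then show "(\<integral>\<^sup>+ a. ennreal (power_spectrum (a - m)) \<partial>lborel) \<le> 1"
      using nn_integral_indicator_ft_square_le by simp
  qed
  also have "\<dots> < \<infinity>" by (simp add: of_nat_less_top)
  finally show False using pos by (simp add: ennreal_mult_top)
qed

text \<open>The fraction of the mass of the rows in \<open>F\<close> of the doubly stochastic matrix
  \<open>power_spectrum (l - m + t) / V\<^sup>2\<close> that lies outside of \<open>F \<times> F\<close>, up to normalization.\<close>

definition leak :: "real set \<Rightarrow> real \<Rightarrow> ennreal" where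
  "leak F t = (\<Sum>l\<in>F. \<integral>\<^sup>+ m. ennreal (power_spectrum (l - m + t)) \<partial>count_space (\<Lambda> - F))"

lemma double_trig_sum_le_leak:
  assumes F: "finite F" "F \<subseteq> \<Lambda>"
  shows "(\<integral>\<^sup>+ x. indicator E x * (\<integral>\<^sup>+ y. indicator E (x - y) *
        ennreal ((cmod (trig_sum F y))\<^sup>2 * (1 - cos (2 * pi * (t * y)))) \<partial>lborel) \<partial>lborel) \<le> leak F t"
proof -
  let ?d = "\<lambda>l. V\<^sup>2 - (\<Sum>m\<in>F. power_spectrum (l - m + t))"
  \<comment> \<open>The single row deficits come without a sign, so they are truncated at 0 before
    \<open>ennreal\<close> is moved inside the sum.\<close>
  have "ennreal (\<Sum>l\<in>F. ?d l) \<le> ennreal (\<Sum>l\<in>F. max 0 (?d l))"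
    by (intro ennreal_leI sum_mono) auto
  also have "\<dots> = (\<Sum>l\<in>F. ennreal (max 0 (?d l)))"
    by (rule sum_ennreal[symmetric]) simp
  also have "\<dots> = (\<Sum>l\<in>F. ennreal (?d l))"
    by (intro sum.cong) (auto simp: max_def ennreal_neg)
  also have "\<dots> \<le> leak F t"
    unfolding leak_def
  proof (rule sum_mono)
    fix l
    have "ennreal (V\<^sup>2) \<le> ennreal (\<Sum>m\<in>F. power_spectrum (l - m + t))
        + (\<integral>\<^sup>+ m. ennreal (power_spectrum (l - m + t)) \<partial>count_space (\<Lambda> - F))"
      using Parseval_le[OF F, of "l + t"] by (simp add: algebra_simps)
    then show "ennreal (?d l) \<le> (\<integral>\<^sup>+ m. ennreal (power_spectrum (l - m + t)) \<partial>count_space (\<Lambda> - F))"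
      by (subst ennreal_minus[symmetric]) (auto simp: sum_nonneg ennreal_minus_le_iff)
  qed
  finally show ?thesis unfolding double_trig_sum[OF F] .
qed

text \<open>Rows with |l| \<le> r - R - 1 see only frequencies beyond R, because |m| > r and t < 1;
  each loses at most \<open>\<tau>\<close>. The other rows lie in two intervals of length R + 1 with
  at most 8 (R + 1) + 2 points each, 16 R + 20 in all, and lose at most 1 each.\<close>

lemma nn_integral_leak_le:
  fixes R r \<tau> :: real
  assumes F: "F = \<Lambda> \<inter> {- r..r}" "finite F"
    and R: "0 \<le> R" and tail: "(\<integral>\<^sup>+ u. ennreal (power_spectrum u) * indicator {u. R < \<bar>u\<bar>} u \<partial>lborel) \<le> ennreal \<tau>"
    and \<tau>: "0 \<le> \<tau>"
  shows "(\<integral>\<^sup>+ t. indicator {1 / 4..<3 / 8} t * leak F t \<partial>lborel) \<le> ennreal (card F * \<tau> + 16 * R + 20)"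
proof -
  let ?I = "{1 / 4..<3 / 8 :: real}"
  let ?A = "\<lambda>l. \<integral>\<^sup>+ t. indicator ?I t * (\<integral>\<^sup>+ m. ennreal (power_spectrum (l - m + t)) \<partial>count_space (\<Lambda> - F)) \<partial>lborel"
  have cs: "countable (\<Lambda> - F)" using countable by auto
  have [measurable]: "(\<lambda>t. \<integral>\<^sup>+ m. ennreal (power_spectrum (l - m + t)) \<partial>count_space (\<Lambda> - F)) \<in> borel_measurable borel" for l
    by (rule borel_measurable_nn_integral_count_space[OF cs]) measurable
  have sep: "1 / 8 \<le> \<bar>l - m\<bar>" if "l \<in> \<Lambda> - F" "m \<in> \<Lambda> - F" "l \<noteq> m" for l m
    using separated that by blast
  have A1: "?A l \<le> 1" for l
  proof -
    have "?A l \<le> (\<integral>\<^sup>+ u. ennreal (power_spectrum u) * indicator UNIV u \<partial>lborel)"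
      by (rule nn_integral_separated_translates_le[OF cs sep]) auto
    also have "\<dots> \<le> 1" using nn_integral_indicator_ft_square_le by simp
    finally show ?thesis .
  qed
  have A2: "?A l \<le> ennreal \<tau>" if l: "\<bar>l\<bar> \<le> r - R - 1" for l
  proof -
    have "?A l \<le> (\<integral>\<^sup>+ u. ennreal (power_spectrum u) * indicator {u. R < \<bar>u\<bar>} u \<partial>lborel)"
    proof (rule nn_integral_separated_translates_le[OF cs sep])
      fix m t :: real assume "m \<in> \<Lambda> - F" "t \<in> ?I"
      then have "\<not> \<bar>m\<bar> \<le> r" "0 \<le> t" "t < 1" using F by auto
      then show "l - m + t \<in> {u. R < \<bar>u\<bar>}" using l by auto
    qed auto
    then show ?thesis using tail by simp
  qed
  define B where "B = {l \<in> F. r - R - 1 < \<bar>l\<bar>}"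
  have cardB: "real (card B) \<le> 16 * R + 20"
  proof -
    let ?J = "\<Lambda> \<inter> {r - R - 1..r}" and ?J' = "\<Lambda> \<inter> {- r..- (r - R - 1)}"
    have J: "r - R - 1 \<le> r" "- r \<le> - (r - R - 1)" using R by auto
    have "B \<subseteq> ?J \<union> ?J'" unfolding B_def F(1) by auto
    then have "card B \<le> card (?J \<union> ?J')"
      by (intro card_mono finite_UnI finite_Int_interval J)
    also have "\<dots> \<le> card ?J + card ?J'" by (rule card_Un_le)
    finally show ?thesis using card_Int_interval[OF J(1)] card_Int_interval[OF J(2)] by simp
  qed
  have "(\<integral>\<^sup>+ t. indicator ?I t * leak F t \<partial>lborel) = (\<Sum>l\<in>F. ?A l)"
    unfolding leak_def sum_distrib_left by (rule nn_integral_sum) measurable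
  also have "\<dots> \<le> (\<Sum>l\<in>F. ennreal (\<tau> + (if l \<in> B then 1 else 0)))"
  proof (rule sum_mono)
    fix l assume "l \<in> F"
    show "?A l \<le> ennreal (\<tau> + (if l \<in> B then 1 else 0))"
    proof (cases "l \<in> B")
      case True
      have "1 \<le> ennreal (\<tau> + 1)" using \<tau> by (simp add: ennreal_ge_1)
      then show ?thesis using True A1[of l] by (simp add: order_trans)
    next
      case False
      then show ?thesis using \<open>l \<in> F\<close> A2[of l] by (simp add: B_def)
    qed
  qed
  also have "\<dots> = ennreal (\<Sum>l\<in>F. \<tau> + (if l \<in> B then 1 else 0))"
    using \<tau> by (intro sum_ennreal) auto
  also have "(\<Sum>l\<in>F. \<tau> + (if l \<in> B then 1 else 0)) = card F * \<tau> + card B"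
  proof -
    have "F \<inter> {l. l \<in> B} = B" by (auto simp: B_def)
    then show ?thesis using F(2) by (simp add: sum.distrib sum.If_cases)
  qed
  also have "ennreal (card F * \<tau> + card B) \<le> ennreal (card F * \<tau> + 16 * R + 20)"
    using cardB by (intro ennreal_leI) simp
  finally show ?thesis .
qed

text \<open>For every t in the window, |G| V card F is at most a constant times the leak. On average
  over t the leak is at most \<open>\<tau>\<close> card F plus a term independent of F, which is
  impossible for small \<open>\<tau>\<close> and large F.\<close>

lemma no_dominated_gap:
  fixes G :: "real set" and C \<delta> :: real
  assumes sets_G [measurable]: "G \<in> sets borel" and G: "0 < emeasure lborel G" "emeasure lborel G < \<infinity>"
    and C: "0 < C" and \<delta>: "0 < \<delta>"
    and near: "\<And>y. \<bar>y\<bar> < \<delta> \<Longrightarrow> G \<inter> (\<lambda>x. x + y) ` E = {}"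
    and dom: "\<And>y. emeasure lborel (G \<inter> (\<lambda>x. x + y) ` E) \<le> ennreal C * emeasure lborel (E \<inter> (\<lambda>x. x + y) ` E)"
  shows False
proof -
  define g where "g = measure lborel G"
  have g1: "emeasure lborel G = ennreal g"
    unfolding g_def using G by (intro emeasure_eq_ennreal_measure) auto
  moreover have "0 < g" using G(1) unfolding g1 by simp
  ultimately have g: "emeasure lborel G = ennreal g" "0 < g" .
  \<comment> \<open>For t in the window and \<open>\<delta>\<close> \<le> |y| \<le> 1, the angle 2
    pi t |y| lies between \<open>pi / 2 * min \<delta> 1\<close> and pi, where the cosine decreases.
    The minimum with 1 keeps the lower end at most pi / 2.\<close>
  define c where "c = 1 - cos (pi / 2 * min \<delta> 1)"
  have c: "0 < c"
  proof -
    have "pi / 2 * min \<delta> 1 \<le> pi / 2 * 1" by (intro mult_left_mono) auto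
    then have "cos (pi / 2 * min \<delta> 1) < cos 0"
      using \<delta> pi_gt_zero by (intro cos_monotone_0_pi) auto
    then show ?thesis by (simp add: c_def)
  qed
  let ?I = "{1 / 4..<3 / 8 :: real}"
  have cos_le: "c \<le> 1 - cos (2 * pi * (t * y))" if t: "t \<in> ?I" and y: "\<delta> \<le> \<bar>y\<bar>" "\<bar>y\<bar> \<le> 1" for t y
  proof -
    have "1 / 4 * min \<delta> 1 \<le> t * \<bar>y\<bar>" using t y \<delta> by (intro mult_mono) auto
    then have 1: "2 * pi * (1 / 4 * min \<delta> 1) \<le> 2 * pi * (t * \<bar>y\<bar>)" by (intro mult_left_mono) auto
    have "t * \<bar>y\<bar> \<le> 1 / 2 * 1" using t y by (intro mult_mono) auto
    then have 2: "2 * pi * (t * \<bar>y\<bar>) \<le> 2 * pi * (1 / 2 * 1)" by (intro mult_left_mono) auto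
    have "cos (2 * pi * (t * \<bar>y\<bar>)) \<le> cos (pi / 2 * min \<delta> 1)"
      using 1 2 \<delta> by (intro cos_monotone_0_pi_le) auto
    moreover have "cos (2 * pi * (t * y)) = cos (2 * pi * (t * \<bar>y\<bar>))"
      by (cases "0 \<le> y") auto
    ultimately show ?thesis by (simp add: c_def)
  qed
  have far: "E \<inter> (\<lambda>x. x + y) ` E = {}" if "1 < \<bar>y\<bar>" for y
  proof -
    have "x + y \<notin> {0..1}" if "x \<in> {0..1}" for x
      using that \<open>1 < \<bar>y\<bar>\<close> by auto
    then show ?thesis using E_sub by blast
  qed
  have key: "ennreal (g * (card F * V)) \<le> ennreal (C / c) * leak F t"
    if F: "finite F" "F \<subseteq> \<Lambda>" and t: "t \<in> ?I" for F t
  proof -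
    let ?p = "\<lambda>y. (cmod (trig_sum F y))\<^sup>2"
    let ?q = "\<lambda>y. ?p y * (1 - cos (2 * pi * (t * y)))"
    have "ennreal (g * (card F * V)) = (\<integral>\<^sup>+ x. indicator G x * ennreal (card F * V) \<partial>lborel)"
      by (subst mult.commute, subst nn_integral_cmult_indicator) (use g pos in \<open>simp_all add: ennreal_mult'[symmetric] mult.commute\<close>)
    also have "\<dots> = (\<integral>\<^sup>+ x. indicator G x * (\<integral>\<^sup>+ y. indicator E (x - y) * ennreal (?p y) \<partial>lborel) \<partial>lborel)"
      unfolding convolution_trig_sum[OF F] ..
    also have "\<dots> = (\<integral>\<^sup>+ y. ennreal (?p y) * emeasure lborel (G \<inter> (\<lambda>x. x + y) ` E) \<partial>lborel)"
      by (rule nn_integral_indicator_convolution) (auto intro: lborel.sigma_finite_measure_axioms)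
    also have "\<dots> \<le> (\<integral>\<^sup>+ y. ennreal (C / c) * (ennreal (?q y) * emeasure lborel (E \<inter> (\<lambda>x. x + y) ` E)) \<partial>lborel)"
    proof (rule nn_integral_mono)
      fix y
      \<comment> \<open>Near 0 the translate misses G; beyond 1 it misses E, so domination makes the
        left side vanish too; in between the cosine factor costs only 1 / c.\<close>
      consider "\<bar>y\<bar> < \<delta>" | "1 < \<bar>y\<bar>" | "\<delta> \<le> \<bar>y\<bar>" "\<bar>y\<bar> \<le> 1" by linarith
      then show "ennreal (?p y) * emeasure lborel (G \<inter> (\<lambda>x. x + y) ` E)
          \<le> ennreal (C / c) * (ennreal (?q y) * emeasure lborel (E \<inter> (\<lambda>x. x + y) ` E))"
      proof cases
        case 1
        then show ?thesis by (simp add: near)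
      next
        case 2
        then show ?thesis using dom[of y] far[of y] by simp
      next
        case 3
        have "?p y * C = C / c * (?p y * c)" using c by simp
        also have "\<dots> \<le> C / c * ?q y"
          using cos_le[OF t 3] C c by (intro mult_left_mono) auto
        finally have pC: "ennreal (?p y) * ennreal C \<le> ennreal (C / c) * ennreal (?q y)"
          using C c by (simp add: ennreal_mult'[symmetric] ennreal_leI)
        have "ennreal (?p y) * emeasure lborel (G \<inter> (\<lambda>x. x + y) ` E)
            \<le> ennreal (?p y) * (ennreal C * emeasure lborel (E \<inter> (\<lambda>x. x + y) ` E))"
          by (intro mult_left_mono dom) auto
        also have "\<dots> = (ennreal (?p y) * ennreal C) * emeasure lborel (E \<inter> (\<lambda>x. x + y) ` E)"
          by (simp only: mult.assoc)
        also have "\<dots> \<le> (ennreal (C / c) * ennreal (?q y)) * emeasure lborel (E \<inter> (\<lambda>x. x + y) ` E)"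
          by (intro mult_right_mono pC) auto
        finally show ?thesis by (simp only: mult.assoc)
      qed
    qed
    also have "\<dots> = ennreal (C / c) * (\<integral>\<^sup>+ y. ennreal (?q y) * emeasure lborel (E \<inter> (\<lambda>x. x + y) ` E) \<partial>lborel)"
    proof (rule nn_integral_cmult, rule borel_measurable_times_ennreal)
      show "(\<lambda>y. emeasure lborel (E \<inter> (\<lambda>x. x + y) ` E)) \<in> borel_measurable lborel"
        using measurable_emeasure_Int_shift[OF sets_E sets_E] by simp
    qed measurable
    also have "(\<integral>\<^sup>+ y. ennreal (?q y) * emeasure lborel (E \<inter> (\<lambda>x. x + y) ` E) \<partial>lborel)
        = (\<integral>\<^sup>+ x. indicator E x * (\<integral>\<^sup>+ y. indicator E (x - y) * ennreal (?q y) \<partial>lborel) \<partial>lborel)"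
      by (rule nn_integral_indicator_convolution[symmetric]) (auto intro: lborel.sigma_finite_measure_axioms)
    also have "ennreal (C / c) * \<dots> \<le> ennreal (C / c) * leak F t"
      by (intro mult_left_mono double_trig_sum_le_leak F) auto
    finally show ?thesis .
  qed
  \<comment> \<open>Averaging over the window of length 1 / 8 produces g V card F / 8. With this
    value it equals (C / c) * 2 \<open>\<tau>\<close> card F, twice the linear part of the leak
    bound.\<close>
  define \<tau> where "\<tau> = g * V * c / (16 * C)"
  have \<tau>: "0 < \<tau>" using g pos c C by (simp add: \<tau>_def)
  obtain R where R: "0 \<le> R"
    "(\<integral>\<^sup>+ u. ennreal (power_spectrum u) * indicator {u. R < \<bar>u\<bar>} u \<partial>lborel) \<le> ennreal \<tau>"
    using nn_integral_indicator_ft_square_tail[OF \<tau>] by blast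
  \<comment> \<open>With N points the surplus \<open>\<tau> * N\<close> exceeds the boundary term 16
    R + 20. The leak bound asks for all of \<open>\<Lambda>\<close> in a symmetric interval, so r is
    then taken large enough to catch N points.\<close>
  obtain N :: nat where N: "(16 * R + 20) / \<tau> < real N"
    using reals_Archimedean2 by blast
  obtain F0 where F0: "finite F0" "card F0 = N" "F0 \<subseteq> \<Lambda>"
    using infinite_arbitrarily_large[OF infinite_spectrum] by blast
  obtain r where r: "\<And>l. l \<in> F0 \<Longrightarrow> \<bar>l\<bar> \<le> r" "0 \<le> r"
  proof -
    obtain r where "\<forall>l\<in>F0. norm l \<le> r"
      using finite_imp_bounded[OF F0(1)] by (auto simp: bounded_iff)
    then show thesis by (intro that[of "max r 0"]) fastforce+
  qed
  define F where "F = \<Lambda> \<inter> {- r..r}"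
  have finF: "finite F" unfolding F_def using r(2) by (intro finite_Int_interval) simp
  have F0F: "F0 \<subseteq> F" using F0 r(1) unfolding F_def by (force simp: abs_le_iff)
  have NF: "N \<le> card F" using card_mono[OF finF F0F] F0(2) by simp
  have "ennreal (1 / 8 * (g * (card F * V))) = (\<integral>\<^sup>+ t. indicator ?I t * ennreal (g * (card F * V)) \<partial>lborel)"
    by (subst (2) mult.commute, subst nn_integral_cmult_indicator) (use g in \<open>simp_all add: ennreal_mult'[symmetric]\<close>)
  also have "\<dots> \<le> (\<integral>\<^sup>+ t. ennreal (C / c) * (indicator ?I t * leak F t) \<partial>lborel)"
  proof (rule nn_integral_mono)
    fix t
    show "indicator ?I t * ennreal (g * (card F * V)) \<le> ennreal (C / c) * (indicator ?I t * leak F t)"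
      using key[OF finF, of t] by (cases "t \<in> ?I") (auto simp: F_def)
  qed
  also have "\<dots> = ennreal (C / c) * (\<integral>\<^sup>+ t. indicator ?I t * leak F t \<partial>lborel)"
  proof (rule nn_integral_cmult)
    have "leak F \<in> borel_measurable borel"
      unfolding leak_def using countable
      by (intro borel_measurable_sum borel_measurable_nn_integral_count_space) auto
    then show "(\<lambda>t. indicator ?I t * leak F t) \<in> borel_measurable lborel" by measurable
  qed
  also have "\<dots> \<le> ennreal (C / c) * ennreal (card F * \<tau> + 16 * R + 20)"
    using nn_integral_leak_le[OF F_def finF R] \<tau> by (intro mult_left_mono) auto
  also have "\<dots> = ennreal (C / c * (card F * \<tau> + 16 * R + 20))"
    using C c by (intro ennreal_mult'[symmetric]) simp
  finally have "1 / 8 * (g * (card F * V)) \<le> C / c * (card F * \<tau> + 16 * R + 20)"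
    using C c \<tau> R by (subst (asm) ennreal_le_iff) auto
  moreover have "1 / 8 * (g * (card F * V)) = C / c * (2 * \<tau> * card F)"
    using C c by (simp add: \<tau>_def)
  moreover have "0 < C / c" using C c by simp
  ultimately have "2 * \<tau> * card F \<le> card F * \<tau> + 16 * R + 20"
    by (simp only: mult_le_cancel_left_pos)
  then have "\<tau> * card F \<le> 16 * R + 20" by (simp add: mult.commute)
  moreover have "16 * R + 20 < \<tau> * N" using N \<tau> by (simp add: field_simps)
  moreover have "\<tau> * N \<le> \<tau> * card F" using NF \<tau> by simp
  ultimately show False by linarith
qed

end

section \<open>Application to symmetric Cantor sets\<close>

theorem theorem1p8:
  fixes E :: "real set"
  assumes "symmetric_Cantor_set E"
    and "emeasure lebesgue E > 0"
  shows "\<not> weakly_tiles E (UNIV - E) \<and> \<not> spectral E"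
proof -
  obtain \<xi> where ratio: "\<And>k. 1 \<le> k \<Longrightarrow> 0 < \<xi> k \<and> \<xi> k < 1 / 2" and E: "E = ctail \<xi> 0"
    using assms(1) by (auto simp: symmetric_Cantor_set_def cantor_set_eq_ctail)
  have sets_E [measurable]: "E \<in> sets borel" unfolding E by (rule sets_ctail)
  have E_sub: "E \<subseteq> {0..1}" using ctail_subset[of \<xi> 0, OF ratio] by (simp add: E clen_def)
  interpret unit_interval_subset E using sets_E E_sub by unfold_locales
  have pos: "0 < measure lborel E"
    using assms(2) emeasure_E(1) by (simp add: emeasure_completion)
  obtain p q C \<delta> :: real where pq: "p < q" and C: "0 < C" and \<delta>: "0 < \<delta>"
    and gap: "{p<..<q} \<inter> E = {}"
    and near: "\<And>y. \<bar>y\<bar> < \<delta> \<Longrightarrow> {p<..<q} \<inter> (\<lambda>x. x + y) ` E = {}"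
    and dom: "\<And>y. measure lborel ({p<..<q} \<inter> (\<lambda>x. x + y) ` E) \<le> C * measure lborel (E \<inter> (\<lambda>x. x + y) ` E)"
    using ctail_gap[of \<xi>, OF ratio] pos unfolding E by blast
  let ?G = "{p<..<q}"
  have dom': "emeasure lborel (?G \<inter> (\<lambda>x. x + y) ` E) \<le> ennreal C * emeasure lborel (E \<inter> (\<lambda>x. x + y) ` E)" for y
  proof -
    have fin: "emeasure lborel (A \<inter> (\<lambda>x. x + y) ` E) = ennreal (measure lborel (A \<inter> (\<lambda>x. x + y) ` E))" for A
    proof -
      have "emeasure lborel (A \<inter> (\<lambda>x. x + y) ` E) \<le> emeasure lborel ((\<lambda>x. x + y) ` E)"
        by (intro emeasure_mono) (auto intro: sets_shift_borel)
      also have "\<dots> = ennreal (measure lborel E)"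
        by (simp add: emeasure_lborel_shift emeasure_E(1))
      finally have "emeasure lborel (A \<inter> (\<lambda>x. x + y) ` E) \<noteq> \<infinity>" by (auto simp: top_unique)
      then show ?thesis by (simp add: emeasure_eq_ennreal_measure)
    qed
    show ?thesis unfolding fin using dom[of y] C by (simp add: ennreal_mult'[symmetric] ennreal_leI)
  qed
  have "\<not> weakly_tiles E (UNIV - E)"
    using pq gap dom' by (intro not_weakly_tiles_complement[of E ?G C]) auto
  moreover have "\<not> spectral E"
  proof
    assume "spectral E"
    then obtain \<Lambda> where "countable \<Lambda>"
      and orth: "\<forall>l\<in>\<Lambda>. \<forall>m\<in>\<Lambda>. l \<noteq> m \<longrightarrow> L2_inner E (expo l) (expo m) = 0"
      and comp: "\<forall>f. square_integrable_on f E \<longrightarrow> (\<forall>\<epsilon>>0. \<exists>F c. finite F \<and> F \<subseteq> \<Lambda> \<and>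
              L2_norm_on E (\<lambda>x. f x - (\<Sum>l\<in>F. c l * expo l x)) < \<epsilon>)"
      unfolding spectral_def by blast
    then interpret spectrum E \<Lambda>
      using pos by unfold_locales (auto simp: L2_inner_expo)
    show False
      using pq by (intro no_dominated_gap[of ?G C \<delta>] C \<delta> near dom') auto
  qed
  ultimately show ?thesis ..
qed

end
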